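(* (1) For any two-way monotone tree poset $T$, any $x\in T$ comparable to all elements of $T$, and any $\varepsilon>0$, there exists $\delta>0$ such that for $n$ large enough any family $\mathcal F\subseteq2^{[n]}$ with $|\mathcal F|\ge(h(T)-1+\varepsilon)\binom{n}{\lfloor n/2\rfloor}$ contains a weak copy of $T(x,\delta n)$. (2) For any tree poset $T$ of height $2$, any $x\in T$, and any $\varepsilon>0$, there exists $\delta>0$ such that for $n$ large enough any family $\mathcal F\subseteq2^{[n]}$ with $|\mathcal F|\ge(1+\varepsilon)\binom{n}{\lfloor n/2\rfloor}$ contains a weak copy of $T(x,\delta n)$.
   Context: All posets are finite, $[n]=\{1,\dots,n\}$. A family $\mathcal G$ of sets is a weak copy of a poset $(P,\preceq)$ if there is a bijection $\iota:P\to\mathcal G$ such that $p\preceq q$ implies $\iota(p)\subseteq\iota(q)$. A tree poset is a poset whose undirected Hasse diagram is a tree; its height $h(T)$ is the largest number of elements in a chain. A tree poset is two-way monotone if it contains an element comparable to all of its elements. For a tree poset $T$, $x\in T$ and an integer $d\ge2$, the $d$-blow-up $T(x,d)$ rooted at $x$ is the tree poset whose Hasse diagram is as follows: each $u\in T$ at distance $\rho$ from $x$ in the undirected Hasse diagram of $T$ is replaced with $d^\rho$ elements $u^1,\dots,u^{d^\rho}$; and if $uv$ is an edge of the Hasse diagram of $T$ with $u$ at distance $\rho$ and $v$ at distance $\rho-1$ from $x$, then the $u^i$'s are partitioned into $d^{\rho-1}$ pairwise disjoint sets $U^1,\dots,U^{d^{\rho-1}}$ each of size $d$, and for every $j\in[d^{\rho-1}]$,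 $v^j$ is joined to all members of $U^j$, all these edges being oriented (lower/upper) as $uv$ is. $T(x,\delta n)$ means $T(x,\lfloor\delta n\rfloor)$. *)

theory Defs
  imports Complex_Main
begin

text \<open>
  A finite poset is given by its (reflexive) order relation \<open>T\<close>; its set of elements
  is \<^term>\<open>Field T\<close>, and \<open>(p, q) \<in> T\<close> means that \<open>p\<close> is below \<open>q\<close>.
\<close>

definition finite_poset :: "'a rel \<Rightarrow> bool" where
  "finite_poset T \<longleftrightarrow> finite (Field T) \<and> Partial_order T"

definition hasse :: "'a rel \<Rightarrow> 'a rel" where
  "hasse T = {(p, q). (p, q) \<in> T \<and> p \<noteq> q \<and>
     \<not> (\<exists>z. z \<noteq> p \<and> z \<noteq> q \<and> (p, z) \<in> T \<and> (z, q) \<in> T)}"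

definition hasse_graph :: "'a rel \<Rightarrow> 'a rel" where
  "hasse_graph T = hasse T \<union> (hasse T)\<inverse>"

text \<open>
  A simple undirected graph is a vertex set with a symmetric edge relation.  Cycles have at least
  three vertices, so traversing one edge back and forth does not count.
\<close>

definition is_cycle :: "'a rel \<Rightarrow> 'a list \<Rightarrow> bool" where
  "is_cycle E c \<longleftrightarrow> 3 \<le> length c \<and> distinct c \<and>
     successively (\<lambda>u v. (u, v) \<in> E) c \<and> (last c, hd c) \<in> E"

definition is_tree :: "'a set \<Rightarrow> 'a rel \<Rightarrow> bool" where
  "is_tree V E \<longleftrightarrow> V \<noteq> {} \<and> (\<forall>u\<in>V. \<forall>v\<in>V. (u, v) \<in> E\<^sup>*) \<and> \<not> (\<exists>c. is_cycle E c)"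

definition tree_poset :: "'a rel \<Rightarrow> bool" where
  "tree_poset T \<longleftrightarrow> finite_poset T \<and> is_tree (Field T) (hasse_graph T)"

definition poset_height :: "'a rel \<Rightarrow> nat" where
  "poset_height T = Max (card ` Chains T)"

definition comparable_to_all :: "'a rel \<Rightarrow> 'a \<Rightarrow> bool" where
  "comparable_to_all T x \<longleftrightarrow> (\<forall>y\<in>Field T. (x, y) \<in> T \<or> (y, x) \<in> T)"

definition two_way_monotone :: "'a rel \<Rightarrow> bool" where
  "two_way_monotone T \<longleftrightarrow> tree_poset T \<and> (\<exists>x\<in>Field T. comparable_to_all T x)"

definition hasse_dist :: "'a rel \<Rightarrow> 'a \<Rightarrow> 'a \<Rightarrow> nat" where
  "hasse_dist T x y = (LEAST k. (x, y) \<in> hasse_graph T ^^ k)"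

text \<open>
  The \<open>d\<close>-blow-up.  The copies of \<open>u\<close>, at distance \<open>\<rho>\<close> from the root, are the pairs
  \<open>(u, i)\<close> with \<open>i < d ^ \<rho>\<close> (numbered from \<open>0\<close>).  For an edge between \<open>u\<close> and a vertex \<open>v\<close> at
  distance \<open>\<rho> - 1\<close>, the partition of the copies of \<open>u\<close> into \<open>d ^ (\<rho> - 1)\<close> classes of size \<open>d\<close> is
  chosen as the one into the blocks \<open>{i. i div d = j}\<close>; any other choice gives an isomorphic poset.
\<close>

definition blowup_elems :: "'a rel \<Rightarrow> 'a \<Rightarrow> nat \<Rightarrow> ('a \<times> nat) set" where
  "blowup_elems T x d = {(u, i). u \<in> Field T \<and> i < d ^ hasse_dist T x u}"

definition blowup_edges :: "'a rel \<Rightarrow> 'a \<Rightarrow> nat \<Rightarrow> ('a \<times> nat) rel" where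
  "blowup_edges T x d = {((u, i), (v, j)).
     (u, i) \<in> blowup_elems T x d \<and> (v, j) \<in> blowup_elems T x d \<and> (u, v) \<in> hasse T \<and>
     (hasse_dist T x u = hasse_dist T x v + 1 \<and> i div d = j \<or>
      hasse_dist T x v = hasse_dist T x u + 1 \<and> j div d = i)}"

definition blowup :: "'a rel \<Rightarrow> 'a \<Rightarrow> nat \<Rightarrow> ('a \<times> nat) rel" where
  "blowup T x d = Id_on (blowup_elems T x d) \<union> (blowup_edges T x d)\<^sup>+"

definition weak_copy :: "'a rel \<Rightarrow> 'b set set \<Rightarrow> bool" where
  "weak_copy P G \<longleftrightarrow> (\<exists>\<iota>. bij_betw \<iota> (Field P) G \<and> (\<forall>(p, q)\<in>P. \<iota> p \<subseteq> \<iota> q))"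

definition contains_weak_copy :: "'b set set \<Rightarrow> 'a rel \<Rightarrow> bool" where
  "contains_weak_copy F P \<longleftrightarrow> (\<exists>G\<subseteq>F. weak_copy P G)"

text \<open>
  The following facts confirm that the blow-up is a finite poset with the prescribed elements
  and the prescribed Hasse diagram, and that the blocks have size \<open>d\<close>.
\<close>

lemma blowup_edges_trancl_elems:
  "(a, b) \<in> (blowup_edges T x d)\<^sup>+ \<Longrightarrow> a \<in> blowup_elems T x d \<and> b \<in> blowup_elems T x d"
  by (induction rule: trancl_induct) (auto simp: blowup_edges_def)

lemma Field_blowup: "Field (blowup T x d) = blowup_elems T x d"
  using blowup_edges_trancl_elems unfolding blowup_def Field_def by fastforce

lemma blowup_edges_trancl_less:
  assumes "finite_poset T" "(a, b) \<in> (blowup_edges T x d)\<^sup>+"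
  shows "(fst a, fst b) \<in> T \<and> fst a \<noteq> fst b"
  using assms(2)
proof (induction rule: trancl_induct)
  case (base b)
  then show ?case by (auto simp: blowup_edges_def hasse_def)
next
  case (step b c)
  then have "(fst b, fst c) \<in> T" "fst b \<noteq> fst c"
    by (auto simp: blowup_edges_def hasse_def)
  moreover have "trans T" "antisym T"
    using assms(1) by (auto simp: finite_poset_def order_on_defs)
  ultimately show ?case
    using step.IH by (metis antisymD transD)
qed

lemma finite_poset_blowup:
  assumes "finite_poset T"
  shows "finite_poset (blowup T x d)"
proof -
  let ?V = "blowup_elems T x d" and ?E = "blowup_edges T x d"
  have "?V = (SIGMA u:Field T. {..<d ^ hasse_dist T x u})"
    by (auto simp: blowup_elems_def)
  then have "finite ?V"
    using assms by (simp add: finite_poset_def)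
  moreover have "trans (blowup T x d)"
    unfolding blowup_def by (auto simp: trans_def intro: trancl_trans)
  moreover have "antisym (blowup T x d)"
  proof (rule antisymI)
    fix a b assume "(a, b) \<in> blowup T x d" "(b, a) \<in> blowup T x d"
    then show "a = b"
      using blowup_edges_trancl_less[OF assms, of a a] unfolding blowup_def
      by (auto dest: trancl_trans)
  qed
  moreover have "blowup T x d \<subseteq> ?V \<times> ?V" "refl_on ?V (blowup T x d)"
    using blowup_edges_trancl_elems by (fastforce simp: blowup_def refl_on_def)+
  ultimately show ?thesis
    by (simp add: finite_poset_def order_on_defs Field_blowup)
qed

lemma hasse_iff:
  "(p, q) \<in> hasse T \<longleftrightarrow> (p, q) \<in> T \<and> p \<noteq> q \<and>
     \<not> (\<exists>z. z \<noteq> p \<and> z \<noteq> q \<and> (p, z) \<in> T \<and> (z, q) \<in> T)"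
  by (simp add: hasse_def)

lemma hasse_blowup:
  assumes "finite_poset T"
  shows "hasse (blowup T x d) = blowup_edges T x d"
proof (intro equalityI subrelI)
  let ?E = "blowup_edges T x d"
  fix a b assume ab: "(a, b) \<in> hasse (blowup T x d)"
  then have "(a, b) \<in> ?E\<^sup>+"
    by (auto simp: hasse_def blowup_def)
  then show "(a, b) \<in> ?E"
  proof (cases rule: tranclE)
    case (step c)
    then have cb: "(c, b) \<in> ?E\<^sup>+" by blast
    have "fst a \<noteq> fst c" "fst c \<noteq> fst b"
      using blowup_edges_trancl_less[OF assms step(1)] blowup_edges_trancl_less[OF assms cb]
      by simp_all
    moreover have "(a, c) \<in> blowup T x d" "(c, b) \<in> blowup T x d"
      using step(1) cb by (simp_all add: blowup_def)
    ultimately have False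
      using ab unfolding hasse_iff by metis
    then show ?thesis ..
  qed
next
  let ?E = "blowup_edges T x d"
  fix a b assume ab: "(a, b) \<in> ?E"
  then have cov: "(fst a, fst b) \<in> hasse T"
    by (auto simp: blowup_edges_def)
  have "\<not> ((a, z) \<in> ?E\<^sup>+ \<and> (z, b) \<in> ?E\<^sup>+)" for z
  proof
    assume z: "(a, z) \<in> ?E\<^sup>+ \<and> (z, b) \<in> ?E\<^sup>+"
    have "(fst a, fst z) \<in> T \<and> fst a \<noteq> fst z" "(fst z, fst b) \<in> T \<and> fst z \<noteq> fst b"
      using blowup_edges_trancl_less[OF assms conjunct1[OF z]]
        blowup_edges_trancl_less[OF assms conjunct2[OF z]] by simp_all
    then show False
      using cov unfolding hasse_iff by metis
  qed
  then have "\<not> (\<exists>z. z \<noteq> a \<and> z \<noteq> b \<and> (a, z) \<in> blowup T x d \<and> (z, b) \<in> blowup T x d)"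
    unfolding blowup_def Un_iff Id_on_iff by metis
  moreover have "a \<noteq> b"
    using cov by (auto simp: hasse_iff)
  moreover have "(a, b) \<in> blowup T x d"
    using ab by (auto simp: blowup_def)
  ultimately show "(a, b) \<in> hasse (blowup T x d)"
    by (simp add: hasse_iff)
qed

lemma blowup_block:
  fixes d j r :: nat
  assumes "d > 0" "j < d ^ r"
  shows "{i. i < d ^ Suc r \<and> i div d = j} = {j * d..<j * d + d}"
proof -
  have le: "j * d + d \<le> d ^ Suc r"
    using mult_le_mono1[of "Suc j" "d ^ r" d] assms by (simp add: algebra_simps)
  have iff: "i div d = j \<longleftrightarrow> j * d \<le> i \<and> i < j * d + d" for i
  proof
    assume "i div d = j"
    then show "j * d \<le> i \<and> i < j * d + d"
      using assms(1) dividend_less_div_times[of d i] by (auto simp: algebra_simps)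
  next
    assume "j * d \<le> i \<and> i < j * d + d"
    then show "i div d = j"
      by (intro div_nat_eqI) (auto simp: algebra_simps)
  qed
  show ?thesis
    unfolding iff using le by (auto simp del: power_Suc)
qed

end

theory Submission
  imports Defs
begin

text \<open>
  The proof studies a uniformly random maximal chain of the power set of \<open>X\<close>.  The expected
  number of members of a family \<open>\<F>\<close> on the chain is its Lubell mass, which is at least
  \<open>|\<F>|\<close> divided by the middle binomial coefficient.  For a set \<open>v\<close>, let the degree of
  \<open>v\<close> upwards (downwards) into \<open>\<G>\<close> be the expected number of members of \<open>\<G>\<close>
  strictly above (below) \<open>v\<close> on a random chain conditioned to pass through \<open>v\<close>.

  Finding rich sets.  If \<open>N\<close> members lie on the chain, then \<open>N - 1\<close> is at most the number of
  pairs of members on it.  Taking expectations bounds the mass of a family by 1 plus the sum of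
  its degrees, weighted by the probability of being hit
  (\<open>lubell_le_1_plus_pair_weight\<close>).  So a family all of whose degrees are at
  most \<open>c\<close> has mass at most \<open>1 / (1 - c)\<close>: it is nearly as light as an antichain.  For part
  (1), let \<open>x\<close> have \<open>a\<close> levels of the tree above it and \<open>b\<close> below it, so that
  \<open>a + b\<close> is at most the height minus 1.  Removing the members of low degree \<open>a\<close> times
  upwards, and separately \<open>b\<close> times downwards, costs a mass of at most
  \<open>(a + b) / (1 - c)\<close>, hence some set survives both processes and can serve as the image of
  \<open>x\<close>: it has large degree into the family left one round earlier, whose members have large
  degree into the family before that, and so on.  For part (2), choosing subfamilies
  \<open>\<L>\<close>, \<open>\<U>\<close> that maximise a penalised number of pairs yields lower and upper sets with
  large degrees into each other.

  Embedding the blow-up.  What remains is the embedding of a rooted tree, in which every edge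
  leads into a pool of sets of degree at least \<open>c\<close> (\<open>rooted_tree_embedding\<close>).
  The difficulty is injectivity: the blow-up has polynomially many elements, whereas a set may
  have only linearly many neighbours in the pool, many of them shared with other sets.  The
  neighbours \<open>w\<close> of \<open>v\<close> are divided according to the gap, the size of the symmetric
  difference of \<open>v\<close> and \<open>w\<close>, and one of the two kinds carries at least half of the degree.

  \<^item> If it is the gaps of size at most \<open>K\<close>, distinct increments are used that avoid a set of
    \<open>O(\<delta>n)\<close> reserved elements attached to \<open>v\<close>, and the new increments are added to the
    reservation.  Two sets that differ in an element reserved by both will then have
    distinct descendants for as long as only small gaps are used.
  \<^item> If it is the gaps above \<open>K\<close>, a single neighbour has probability \<open>O(n^(- K - 1))\<close>, so
    the neighbours can be chosen outside the Hamming balls of radius \<open>2R\<close> around everything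
    embedded so far, provided that \<open>K\<close> exceeds \<open>2R\<close> by the exponent of the size of the
    blow-up.

  Both cases preserve the invariant \<open>separated\<close>, whose radius shrinks by \<open>K\<close> with each
  vertex of the tree.  There are boundedly many vertices, so all constants depend only on the
  tree and on \<open>c\<close>.
\<close>

section \<open>Degrees and random maximal chains\<close>

text \<open>
  Upward and downward steps obey the same rules, so a Boolean \<open>up\<close> selects the direction.
  A step from \<open>v\<close> is the symmetric difference with a nonempty subset of \<open>room X up v\<close>.
\<close>
definition toward :: "bool \<Rightarrow> 'b set \<Rightarrow> 'b set \<Rightarrow> bool" where
  "toward up v w \<longleftrightarrow> (if up then v \<subset> w else w \<subset> v)"

definition room :: "'b set \<Rightarrow> bool \<Rightarrow> 'b set \<Rightarrow> 'b set" where
  "room X up v = (if up then X - v else v)"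

text \<open>
  A random maximal chain through \<open>v\<close> contains \<open>w\<close> with probability 1 over the number of subsets
  of \<open>room X up v\<close> that have the size of the step from \<open>v\<close> to \<open>w\<close>; so this is the expected number
  of members of \<open>\<G>\<close> that the chain contains strictly above or strictly below \<open>v\<close>.
\<close>
definition degree :: "'b set \<Rightarrow> bool \<Rightarrow> 'b set \<Rightarrow> 'b set set \<Rightarrow> real" where
  "degree X up v \<G> =
     (\<Sum>w | w \<in> \<G> \<and> toward up v w. 1 / real (card (room X up v) choose card (sym_diff v w)))"

text \<open>
  The Lubell mass: the expected number of members on a random maximal chain.
\<close>
definition lubell :: "'b set \<Rightarrow> 'b set set \<Rightarrow> real" where
  "lubell X \<G> = (\<Sum>w\<in>\<G>. 1 / real (card X choose card w))"

lemma degree_nonneg: "0 \<le> degree X up v \<G>"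
  by (simp add: degree_def sum_nonneg)

lemma lubell_nonneg: "0 \<le> lubell X \<G>"
  by (simp add: lubell_def sum_nonneg)

lemma degree_up: "degree X True v \<G> =
    (\<Sum>w | w \<in> \<G> \<and> v \<subset> w. 1 / real (card (X - v) choose card (w - v)))"
proof -
  have "sym_diff v w = w - v" if "v \<subset> w" for w
    using that by blast
  then show ?thesis
    by (simp add: degree_def toward_def room_def cong: conj_cong)
qed

lemma degree_down:
  assumes "finite v"
  shows "degree X False v \<G> = (\<Sum>w | w \<in> \<G> \<and> w \<subset> v. 1 / real (card v choose card w))"
proof -
  have "card v choose card (sym_diff v w) = card v choose card w" if "w \<subset> v" for w
  proof -
    have "sym_diff v w = v - w" using that by blast
    moreover have "card (v - w) = card v - card w" "card w \<le> card v"
      using that assms by (auto intro: card_Diff_subset card_mono finite_subset)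
    ultimately show ?thesis
      by (simp add: binomial_symmetric[symmetric])
  qed
  then show ?thesis
    unfolding degree_def toward_def room_def by (intro sum.cong) auto
qed

text \<open>
  A random maximal chain of the subsets of \<open>A\<close> arises by removing a random point of \<open>A\<close> and
  continuing with a random maximal chain below; the identity is the resulting recursion for
  expectations.
\<close>
lemma average_over_point_removal:
  assumes fin: "finite A" and ne: "A \<noteq> {}" and A: "A \<notin> \<G>" and G: "\<G> \<subseteq> Pow A"
  shows "(\<Sum>w\<in>\<G>. \<phi> w / real (card A choose card w)) =
    (\<Sum>a\<in>A. \<Sum>w | w \<in> \<G> \<and> w \<subseteq> A - {a}. \<phi> w / real (card (A - {a}) choose card w)) / card A"
proof -
  have finG: "finite \<G>" using G fin by (meson finite_Pow_iff finite_subset)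
  have "(\<Sum>a\<in>A. \<Sum>w | w \<in> \<G> \<and> w \<subseteq> A - {a}. \<phi> w / real (card (A - {a}) choose card w))
      = (\<Sum>a\<in>A. \<Sum>w | w \<in> \<G> \<and> w \<subseteq> A - {a}. \<phi> w / real (card A - 1 choose card w))"
    using fin by (intro sum.cong refl) simp
  also have "\<dots> = (\<Sum>w\<in>\<G>. \<Sum>a | a \<in> A \<and> w \<subseteq> A - {a}. \<phi> w / real (card A - 1 choose card w))"
    using fin finG by (rule sum.swap_restrict)
  also have "\<dots> = (\<Sum>w\<in>\<G>. real (card A) * (\<phi> w / real (card A choose card w)))"
  proof (rule sum.cong[OF refl])
    fix w assume w: "w \<in> \<G>"
    then have wA: "w \<subset> A" using G A by blast
    then have lt: "card w < card A" using fin by (simp add: psubset_card_mono)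
    have "{a. a \<in> A \<and> w \<subseteq> A - {a}} = A - w" using wA by blast
    moreover have "card (A - w) = card A - card w"
      using wA fin by (intro card_Diff_subset) (auto intro: finite_subset)
    moreover have "(card A - card w) * (card A choose card w) = card A * (card A - 1 choose card w)"
      by (rule binomial_absorb_comp)
    then have "real (card A - card w) * real (card A choose card w)
        = real (card A) * real (card A - 1 choose card w)"
      by (metis of_nat_mult)
    moreover have "0 < (card A choose card w)" "0 < (card A - 1 choose card w)"
      using lt by auto
    ultimately show "(\<Sum>a | a \<in> A \<and> w \<subseteq> A - {a}. \<phi> w / real (card A - 1 choose card w)) =
        real (card A) * (\<phi> w / real (card A choose card w))"
      by (simp add: field_simps)
  qed
  also have "\<dots> = real (card A) * (\<Sum>w\<in>\<G>. \<phi> w / real (card A choose card w))"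
    by (simp add: sum_distrib_left)
  finally show ?thesis using fin ne by simp
qed

text \<open>
  The expectation of the number of members on a chain minus the number of pairs of members on
  it. By the recursion, only ground sets \<open>A\<close> that belong to the family need an argument: then
  \<open>A\<close> tops every chain, and the pairs with \<open>A\<close> alone make up for all the other members.
\<close>
lemma lubell_minus_pairs_le_1:
  assumes "finite X" "\<G> \<subseteq> Pow X"
  shows "(\<Sum>w\<in>\<G>. (1 - degree X False w \<G>) / real (card X choose card w)) \<le> 1"
proof -
  define \<phi> where "\<phi> w = 1 - degree X False w \<G>" for w
  have "(\<Sum>w | w \<in> \<G> \<and> w \<subseteq> A. \<phi> w / real (card A choose card w)) \<le> 1" if "finite A" for A
    using that
  proof (induction A rule: finite_psubset_induct)
    case (psubset A)
    let ?H = "{w. w \<in> \<G> \<and> w \<subset> A}"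
    have finH: "finite ?H" using psubset.hyps by (auto intro: finite_subset[of _ "Pow A"])
    show ?case
    proof (cases "A \<in> \<G>")
      case True
      have eq: "{w. w \<in> \<G> \<and> w \<subseteq> A} = insert A ?H" using True by blast
      have "(\<Sum>w\<in>?H. \<phi> w / real (card A choose card w)) \<le> (\<Sum>w\<in>?H. 1 / real (card A choose card w))"
        by (intro sum_mono divide_right_mono) (auto simp: \<phi>_def degree_nonneg)
      also have "\<dots> = degree X False A \<G>"
        by (simp add: degree_down psubset.hyps)
      finally show ?thesis
        unfolding eq using finH by (simp add: \<phi>_def)
    next
      case False
      then have eq: "{w. w \<in> \<G> \<and> w \<subseteq> A} = ?H" by blast
      show ?thesis
      proof (cases "A = {}")
        case True
        then have "?H = {}" by blast
        show ?thesis unfolding eq \<open>?H = {}\<close> by simp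
      next
        case ne: False
        have "(\<Sum>w\<in>?H. \<phi> w / real (card A choose card w)) =
          (\<Sum>a\<in>A. \<Sum>w | w \<in> ?H \<and> w \<subseteq> A - {a}. \<phi> w / real (card (A - {a}) choose card w)) / card A"
          using psubset.hyps ne by (intro average_over_point_removal) auto
        also have "\<dots> \<le> (\<Sum>a\<in>A. 1) / card A"
        proof (intro divide_right_mono sum_mono)
          fix a assume a: "a \<in> A"
          have *: "{w. w \<in> ?H \<and> w \<subseteq> A - {a}} = {w. w \<in> \<G> \<and> w \<subseteq> A - {a}}" using a by blast
          show "(\<Sum>w | w \<in> ?H \<and> w \<subseteq> A - {a}. \<phi> w / real (card (A - {a}) choose card w)) \<le> 1"
            unfolding * by (rule psubset.IH) (use a in blast)
        qed simp
        also have "\<dots> = 1" using ne psubset.hyps by simp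
        finally show ?thesis unfolding eq .
      qed
    qed
  qed
  from this[OF assms(1)] have "(\<Sum>w | w \<in> \<G> \<and> w \<subseteq> X. \<phi> w / real (card X choose card w)) \<le> 1" .
  moreover have "{w. w \<in> \<G> \<and> w \<subseteq> X} = \<G>" using assms by blast
  ultimately show ?thesis by (simp add: \<phi>_def)
qed

text \<open>
  The expected number of pairs \<open>l \<subset> u\<close> on a random maximal chain with \<open>l \<in> \<L>\<close> and
  \<open>u \<in> \<U>\<close>, computed by conditioning on \<open>u\<close>.
\<close>
definition pair_weight :: "'b set \<Rightarrow> 'b set set \<Rightarrow> 'b set set \<Rightarrow> real" where
  "pair_weight X \<L> \<U> =
     (\<Sum>u\<in>\<U>. degree X False u \<L> / real (card X choose card u))"

text \<open>
  The same expectation, computed by conditioning on the lower set of the pair.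
\<close>
lemma pair_weight_eq_up:
  assumes X: "finite X" and L: "\<L> \<subseteq> Pow X" and U: "\<U> \<subseteq> Pow X"
  shows "pair_weight X \<L> \<U> = (\<Sum>l\<in>\<L>. degree X True l \<U> / real (card X choose card l))"
proof -
  have fin: "finite \<L>" "finite \<U>" using X L U by (meson finite_Pow_iff finite_subset)+
  have "pair_weight X \<L> \<U> = (\<Sum>u\<in>\<U>. \<Sum>l | l \<in> \<L> \<and> l \<subset> u.
      1 / (real (card u choose card l) * real (card X choose card u)))"
    unfolding pair_weight_def
  proof (intro sum.cong refl)
    fix u assume "u \<in> \<U>"
    then have "finite u" using U X by (auto intro: finite_subset)
    then show "degree X False u \<L> / real (card X choose card u) = (\<Sum>l | l \<in> \<L> \<and> l \<subset> u.
      1 / (real (card u choose card l) * real (card X choose card u)))"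
      by (simp add: degree_down sum_divide_distrib)
  qed
  also have "\<dots> = (\<Sum>l\<in>\<L>. \<Sum>u | u \<in> \<U> \<and> l \<subset> u.
      1 / (real (card u choose card l) * real (card X choose card u)))"
    using fin by (intro sum.swap_restrict)
  also have "\<dots> = (\<Sum>l\<in>\<L>. degree X True l \<U> / real (card X choose card l))"
  proof (intro sum.cong refl)
    fix l assume l: "l \<in> \<L>"
    have "(\<Sum>u | u \<in> \<U> \<and> l \<subset> u. 1 / (real (card u choose card l) * real (card X choose card u)))
        = (\<Sum>u | u \<in> \<U> \<and> l \<subset> u. 1 / real (card (X - l) choose card (u - l)) / real (card X choose card l))"
    proof (intro sum.cong refl)
      fix u assume "u \<in> {u. u \<in> \<U> \<and> l \<subset> u}"
      then have u: "u \<subseteq> X" "l \<subset> u" using U by auto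
      then have lX: "l \<subseteq> X" "l \<subseteq> u" by auto
      have f: "finite l" "finite u"
        using finite_subset[OF lX(1) X] finite_subset[OF u(1) X] .
      have le: "card l \<le> card u" "card u \<le> card X"
        using u f X by (auto intro: card_mono)
      have cd: "card (X - l) = card X - card l" "card (u - l) = card u - card l"
        using card_Diff_subset[OF f(1) lX(1)] card_Diff_subset[OF f(1) lX(2)] .
      have "real (card X choose card u) * real (card u choose card l)
          = real (card X choose card l) * real (card (X - l) choose card (u - l))"
        unfolding cd of_nat_mult[symmetric] choose_mult[OF le] ..
      then show "1 / (real (card u choose card l) * real (card X choose card u)) =
          1 / real (card (X - l) choose card (u - l)) / real (card X choose card l)"
        by (metis divide_divide_eq_left mult.commute)
    qed
    then show "(\<Sum>u | u \<in> \<U> \<and> l \<subset> u. 1 / (real (card u choose card l) * real (card X choose card u)))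
        = degree X True l \<U> / real (card X choose card l)"
      by (simp add: degree_up sum_divide_distrib)
  qed
  finally show ?thesis .
qed

lemma lubell_le_1_plus_pair_weight:
  assumes "finite X" "\<G> \<subseteq> Pow X"
  shows "lubell X \<G> \<le> 1 + pair_weight X \<G> \<G>"
  using lubell_minus_pairs_le_1[OF assms]
  by (simp add: lubell_def pair_weight_def diff_divide_distrib sum_subtractf)

section \<open>Families of large Lubell mass contain sets of large degree\<close>

lemma lubell_low_degree:
  assumes X: "finite X" and G: "\<G> \<subseteq> Pow X" and c: "c < 1"
    and low: "\<And>v. v \<in> \<G> \<Longrightarrow> degree X up v \<G> \<le> c"
  shows "lubell X \<G> \<le> 1 / (1 - c)"
proof -
  have "pair_weight X \<G> \<G> = (\<Sum>v\<in>\<G>. degree X up v \<G> / real (card X choose card v))"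
    by (cases up) (simp_all add: pair_weight_eq_up[OF X G G] pair_weight_def[of X \<G> \<G>, symmetric])
  also have "\<dots> \<le> (\<Sum>v\<in>\<G>. c / real (card X choose card v))"
    by (intro sum_mono divide_right_mono low) auto
  also have "\<dots> = c * lubell X \<G>"
    by (simp add: lubell_def sum_distrib_left)
  finally have "(1 - c) * lubell X \<G> \<le> 1"
    using lubell_le_1_plus_pair_weight[OF X G] by (simp add: algebra_simps)
  then show ?thesis using c by (simp add: field_simps)
qed

text \<open>
  After \<open>i\<close> rounds, the first step of a path of \<open>i\<close> steps in direction \<open>up\<close> can be made from any
  surviving set, ending in a set that survived \<open>i - 1\<close> rounds.
\<close>
fun peel :: "'b set \<Rightarrow> bool \<Rightarrow> real \<Rightarrow> 'b set set \<Rightarrow> nat \<Rightarrow> 'b set set" where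
  "peel X up c \<F> 0 = \<F>"
| "peel X up c \<F> (Suc i) = {v \<in> peel X up c \<F> i. degree X up v (peel X up c \<F> i) > c}"

lemma peel_subset: "peel X up c \<F> i \<subseteq> \<F>"
  by (induction i) auto

lemma degree_mono: "\<lbrakk>finite \<H>; \<G> \<subseteq> \<H>\<rbrakk> \<Longrightarrow> degree X up v \<G> \<le> degree X up v \<H>"
  unfolding degree_def by (intro sum_mono2) auto

lemma lubell_Un_disjoint:
  assumes "finite \<G>" "\<H> \<subseteq> \<G>"
  shows "lubell X \<G> = lubell X \<H> + lubell X (\<G> - \<H>)"
  unfolding lubell_def using assms by (simp add: sum.subset_diff add.commute)

lemma lubell_Un_le:
  assumes "finite \<G>" "finite \<H>"
  shows "lubell X (\<G> \<union> \<H>) \<le> lubell X \<G> + lubell X \<H>"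
  unfolding lubell_def sum_Un[OF assms] by (simp add: sum_nonneg)

text \<open>
  The members removed in one round have small degree even into each other, so that each round
  costs little more than the mass of an antichain.
\<close>
lemma lubell_peel:
  assumes X: "finite X" and F: "\<F> \<subseteq> Pow X" and c: "c < 1"
  shows "lubell X (\<F> - peel X up c \<F> i) \<le> i / (1 - c)"
proof (induction i)
  case 0
  then show ?case by (simp add: lubell_def)
next
  case (Suc i)
  let ?P = "peel X up c \<F> i" and ?Q = "peel X up c \<F> (Suc i)"
  have finF: "finite \<F>" using X F by (meson finite_Pow_iff finite_subset)
  have PF: "?P \<subseteq> \<F>" by (rule peel_subset)
  have fP: "finite ?P" using PF finF by (rule finite_subset)
  have "lubell X (?P - ?Q) \<le> 1 / (1 - c)"
  proof (rule lubell_low_degree[OF X _ c])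
    show "?P - ?Q \<subseteq> Pow X" using PF F by blast
    fix v assume "v \<in> ?P - ?Q"
    then have "degree X up v ?P \<le> c" by auto
    moreover have "degree X up v (?P - ?Q) \<le> degree X up v ?P"
      by (rule degree_mono[OF fP]) blast
    ultimately show "degree X up v (?P - ?Q) \<le> c" by simp
  qed
  moreover have "lubell X (\<F> - ?Q) = lubell X (\<F> - ?P) + lubell X ((\<F> - ?Q) - (\<F> - ?P))"
    using finF by (intro lubell_Un_disjoint) auto
  moreover have "(\<F> - ?Q) - (\<F> - ?P) = ?P - ?Q" using PF by blast
  ultimately show ?case using Suc.IH by (simp add: add_divide_distrib)
qed

lemma two_way_root_exists:
  assumes X: "finite X" and F: "\<F> \<subseteq> Pow X" and c: "c < 1"
    and big: "lubell X \<F> > (a + b) / (1 - c)"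
  shows "peel X True c \<F> a \<inter> peel X False c \<F> b \<noteq> {}"
proof
  assume *: "peel X True c \<F> a \<inter> peel X False c \<F> b = {}"
  let ?A = "\<F> - peel X True c \<F> a" and ?B = "\<F> - peel X False c \<F> b"
  have fin: "finite \<F>" using X F by (meson finite_Pow_iff finite_subset)
  have "\<F> = ?A \<union> ?B" using * by blast
  then have "lubell X \<F> = lubell X (?A \<union> ?B)" by metis
  also have "\<dots> \<le> lubell X ?A + lubell X ?B"
    using fin by (intro lubell_Un_le) auto
  finally show False
    using lubell_peel[OF X F c, of True a] lubell_peel[OF X F c, of False b] big
    by (simp add: add_divide_distrib)
qed

text \<open>
  The pair is chosen to maximise the pair weight minus \<open>c\<close> times both masses. The value is
  positive because the pair \<open>(\<F>, \<F>)\<close> already has positive value, and maximality says that no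
  member can be dropped with profit, which is the degree condition.
\<close>
lemma high_degree_pair_exists:
  assumes X: "finite X" and F: "\<F> \<subseteq> Pow X" and c: "c \<ge> 0"
    and big: "(1 - 2 * c) * lubell X \<F> > 1"
  obtains \<L> \<U> where "\<L> \<subseteq> \<F>" "\<U> \<subseteq> \<F>" "\<L> \<noteq> {}" "\<U> \<noteq> {}"
    "\<And>l. l \<in> \<L> \<Longrightarrow> degree X True l \<U> \<ge> c" "\<And>u. u \<in> \<U> \<Longrightarrow> degree X False u \<L> \<ge> c"
proof -
  define \<Phi> where "\<Phi> = (\<lambda>(\<L>, \<U>). pair_weight X \<L> \<U> - c * lubell X \<L> - c * lubell X \<U>)"
  have fin: "finite \<F>" using X F by (meson finite_Pow_iff finite_subset)
  let ?S = "Pow \<F> \<times> Pow \<F>"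
  have finS: "finite ?S" using fin by simp
  have neS: "?S \<noteq> {}" by blast
  have "Max (\<Phi> ` ?S) \<in> \<Phi> ` ?S" using finS neS by (intro Max_in) auto
  then obtain p where pS: "p \<in> ?S" and pm: "\<Phi> p = Max (\<Phi> ` ?S)" by auto
  obtain \<L> \<U> where p: "p = (\<L>, \<U>)" by force
  have max: "\<Phi> q \<le> \<Phi> (\<L>, \<U>)" if "q \<in> ?S" for q
    using that finS pm p by auto
  have L: "\<L> \<subseteq> \<F>" "\<U> \<subseteq> \<F>" using pS p by auto
  then have LX: "\<L> \<subseteq> Pow X" "\<U> \<subseteq> Pow X" and fL: "finite \<L>" "finite \<U>"
    using F fin by (auto intro: finite_subset)
  have "0 < \<Phi> (\<F>, \<F>)"
    using lubell_le_1_plus_pair_weight[OF X F] big by (simp add: \<Phi>_def algebra_simps)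
  then have pos: "0 < \<Phi> (\<L>, \<U>)" using max[of "(\<F>, \<F>)"] by auto
  have C: "0 < real (card X choose card v)" if "v \<in> \<F>" for v
    using that F X by (simp add: card_mono subset_iff)
  have "\<L> \<noteq> {}" "\<U> \<noteq> {}"
    using pos mult_nonneg_nonneg[OF c lubell_nonneg[of X \<L>]] mult_nonneg_nonneg[OF c lubell_nonneg[of X \<U>]]
    by (auto simp: \<Phi>_def pair_weight_def degree_def)
  moreover have "degree X True l \<U> \<ge> c" if l: "l \<in> \<L>" for l
  proof -
    have "pair_weight X \<L> \<U> = degree X True l \<U> / real (card X choose card l) + pair_weight X (\<L> - {l}) \<U>"
      using X LX fL l by (subst (1 2) pair_weight_eq_up) (auto simp: sum.remove)
    moreover have "lubell X \<L> = 1 / real (card X choose card l) + lubell X (\<L> - {l})"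
      using fL l by (simp add: lubell_def sum.remove)
    moreover have "\<Phi> (\<L> - {l}, \<U>) \<le> \<Phi> (\<L>, \<U>)"
      using L by (intro max) auto
    ultimately have "c / real (card X choose card l) \<le> degree X True l \<U> / real (card X choose card l)"
      by (simp add: \<Phi>_def algebra_simps)
    then show ?thesis using C[of l] l L by (simp add: divide_le_cancel subset_iff)
  qed
  moreover have "degree X False u \<L> \<ge> c" if u: "u \<in> \<U>" for u
  proof -
    have "pair_weight X \<L> \<U> = degree X False u \<L> / real (card X choose card u) + pair_weight X \<L> (\<U> - {u})"
      using fL u by (simp add: pair_weight_def sum.remove)
    moreover have "lubell X \<U> = 1 / real (card X choose card u) + lubell X (\<U> - {u})"
      using fL u by (simp add: lubell_def sum.remove)
    moreover have "\<Phi> (\<L>, \<U> - {u}) \<le> \<Phi> (\<L>, \<U>)"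
      using L by (intro max) auto
    ultimately have "c / real (card X choose card u) \<le> degree X False u \<L> / real (card X choose card u)"
      by (simp add: \<Phi>_def algebra_simps)
    then show ?thesis using C[of u] u L by (simp add: divide_le_cancel subset_iff)
  qed
  ultimately show thesis using that L by blast
qed

section \<open>Choosing increments\<close>

lemma binomial_mono_middle:
  fixes N :: nat
  assumes "k \<le> g" "g + k \<le> N"
  shows "(N choose k) \<le> (N choose g)"
proof -
  have up: "(N choose k) \<le> (N choose h)" if "k \<le> h" "2 * h \<le> N + 1" for h
    using that
  proof (induction h rule: dec_induct)
    case (step h)
    have "Suc h * (N choose h) \<le> (N - h) * (N choose h)"
      using step.prems by (intro mult_right_mono) auto
    also have "\<dots> = Suc h * (N choose Suc h)"
      using binomial_absorb_comp[of N h] times_binomial_minus1_eq[of "Suc h" N] by simp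
    finally have "(N choose h) \<le> (N choose Suc h)"
      by (metis mult_le_cancel1 zero_less_Suc)
    then show ?case using step by simp
  qed simp
  show ?thesis
  proof (cases "2 * g \<le> N + 1")
    case True
    then show ?thesis using up[of g] assms by simp
  next
    case False
    then have "(N choose k) \<le> (N choose (N - g))" using assms by (intro up) auto
    then show ?thesis using assms by (simp add: binomial_symmetric[symmetric])
  qed
qed

lemma binomial_inverse_le:
  fixes N :: nat
  assumes "0 < k" "k \<le> g" "g + k \<le> N"
  shows "1 / real (N choose g) \<le> (real k / real N) ^ k"
proof -
  have "(real N / real k) ^ k \<le> real (N choose k)"
    using assms binomial_ge_n_over_k_pow_k[of k N, where ?'a = real] by simp
  also have "\<dots> \<le> real (N choose g)"
    using binomial_mono_middle[of k g N] assms by simp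
  finally have "1 / real (N choose g) \<le> 1 / (real N / real k) ^ k"
    using assms by (intro divide_left_mono) (auto intro!: mult_pos_pos)
  then show ?thesis by (simp add: power_divide)
qed

lemma card_subsets_containing:
  assumes "finite B" "a \<in> B" "0 < g"
  shows "card {G. G \<subseteq> B \<and> a \<in> G \<and> card G = g} = (card B - 1) choose (g - 1)"
proof -
  have "bij_betw (insert a) {H. H \<subseteq> B - {a} \<and> card H = g - 1} {G. G \<subseteq> B \<and> a \<in> G \<and> card G = g}"
  proof (intro bij_betw_byWitness[where f' = "\<lambda>G. G - {a}"])
    have "card (insert a H) = g" if "H \<subseteq> B - {a}" "card H = g - 1" for H
    proof -
      have "finite H" "a \<notin> H" using that(1) assms(1) by (auto intro: finite_subset)
      then show ?thesis using that(2) assms(3) by simp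
    qed
    then show "insert a ` {H. H \<subseteq> B - {a} \<and> card H = g - 1} \<subseteq> {G. G \<subseteq> B \<and> a \<in> G \<and> card G = g}"
      using assms(2) by auto
  qed (use assms in auto)
  then have "card {G. G \<subseteq> B \<and> a \<in> G \<and> card G = g} = card {H. H \<subseteq> B - {a} \<and> card H = g - 1}"
    by (simp add: bij_betw_same_card)
  also have "\<dots> = card (B - {a}) choose (g - 1)"
    using assms by (intro n_subsets) auto
  finally show ?thesis using assms by simp
qed

text \<open>
  A random \<open>g\<close>-subset of \<open>B\<close> contains a given point with probability \<open>g / |B|\<close>; a union bound
  over the points of \<open>A\<close> and the sizes \<open>g \<le> K\<close> gives the estimate.
\<close>
lemma weight_of_sets_hitting:
  assumes B: "finite B" and A: "finite A"
  shows "(\<Sum>G | G \<subseteq> B \<and> card G \<le> K \<and> G \<inter> A \<noteq> {}. 1 / real (card B choose card G))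
    \<le> real (K * K * card A) / real (card B)"
proof -
  let ?w = "\<lambda>G. 1 / real (card B choose card G)"
  have one: "(\<Sum>G | G \<subseteq> B \<and> a \<in> G \<and> card G = g. ?w G) \<le> real K / real (card B)"
    if "a \<in> B" "g \<in> {1..K}" for a g
  proof -
    have "(\<Sum>G | G \<subseteq> B \<and> a \<in> G \<and> card G = g. ?w G) =
        real ((card B - 1) choose (g - 1)) / real (card B choose g)"
      using card_subsets_containing[of B a g] that B by simp
    also have "\<dots> \<le> real K / real (card B)"
    proof (cases "g \<le> card B")
      case True
      have "g * (card B choose g) = card B * ((card B - 1) choose (g - 1))"
        using that by (intro times_binomial_minus1_eq) simp
      then have "real g * real (card B choose g) = real (card B) * real ((card B - 1) choose (g - 1))"
        by (metis of_nat_mult)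
      moreover have "real g \<le> real K" using that by simp
      moreover have "0 < real (card B)" "0 < real (card B choose g)"
        using that True by auto
      ultimately have "real (card B) * real ((card B - 1) choose (g - 1)) \<le> real K * real (card B choose g)"
        using mult_right_mono[of "real g" "real K" "real (card B choose g)"] by linarith
      then show ?thesis
        using \<open>0 < real (card B)\<close> \<open>0 < real (card B choose g)\<close> by (simp add: field_simps)
    qed (simp add: not_le binomial_eq_0)
    finally show ?thesis .
  qed
  have "(\<Sum>G | G \<subseteq> B \<and> card G \<le> K \<and> G \<inter> A \<noteq> {}. ?w G)
      \<le> (\<Sum>G\<in>(\<Union>(a, g)\<in>(A \<inter> B) \<times> {1..K}. {G. G \<subseteq> B \<and> a \<in> G \<and> card G = g}). ?w G)"
  proof (rule sum_mono2)
    show "finite (\<Union>(a, g)\<in>(A \<inter> B) \<times> {1..K}. {G. G \<subseteq> B \<and> a \<in> G \<and> card G = g})"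
      by (rule finite_subset[of _ "Pow B"]) (use B in auto)
    show "{G. G \<subseteq> B \<and> card G \<le> K \<and> G \<inter> A \<noteq> {}}
        \<subseteq> (\<Union>(a, g)\<in>(A \<inter> B) \<times> {1..K}. {G. G \<subseteq> B \<and> a \<in> G \<and> card G = g})"
    proof
      fix G assume G: "G \<in> {G. G \<subseteq> B \<and> card G \<le> K \<and> G \<inter> A \<noteq> {}}"
      then obtain a where "a \<in> G" "a \<in> A" by blast
      moreover have "finite G" using G B by (auto intro: finite_subset)
      ultimately have "1 \<le> card G" by (auto simp: Suc_le_eq card_gt_0_iff)
      then have "(a, card G) \<in> (A \<inter> B) \<times> {1..K}"
        using G \<open>a \<in> G\<close> \<open>a \<in> A\<close> by auto
      then show "G \<in> (\<Union>(a, g)\<in>(A \<inter> B) \<times> {1..K}. {G. G \<subseteq> B \<and> a \<in> G \<and> card G = g})"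
        by (rule UN_I) (use G \<open>a \<in> G\<close> in simp)
    qed
  qed simp
  also have "\<dots> \<le> (\<Sum>(a, g)\<in>(A \<inter> B) \<times> {1..K}. \<Sum>G | G \<subseteq> B \<and> a \<in> G \<and> card G = g. ?w G)"
  proof -
    have UN: "sum ?w (\<Union>i\<in>S. M i) \<le> (\<Sum>i\<in>S. sum ?w (M i))"
      if "finite S" "\<And>i. i \<in> S \<Longrightarrow> finite (M i)" for S :: "('a \<times> nat) set" and M
      using that
    proof (induction S rule: finite_induct)
      case (insert i S)
      have fin: "finite (M i)" "finite (\<Union>(M ` S))" using insert by auto
      have "sum ?w (M i \<union> \<Union>(M ` S)) \<le> sum ?w (M i) + sum ?w (\<Union>(M ` S))"
        unfolding sum_Un[OF fin] by (simp add: sum_nonneg)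
      moreover have "sum ?w (\<Union>(M ` S)) \<le> (\<Sum>i\<in>S. sum ?w (M i))"
        using insert by auto
      ultimately show ?case using insert.hyps by simp
    qed simp
    show ?thesis
      unfolding case_prod_unfold
    proof (rule UN)
      show "finite ((A \<inter> B) \<times> {1..K})" using A by simp
      fix i :: "'a \<times> nat"
      show "finite {G. G \<subseteq> B \<and> fst i \<in> G \<and> card G = snd i}"
        using B by (rule finite_subset[rotated, OF finite_Pow_iff[THEN iffD2]]) blast
    qed
  qed
  also have "\<dots> \<le> (\<Sum>(a, g)\<in>(A \<inter> B) \<times> {1..K}. real K / real (card B))"
    using one by (intro sum_mono) auto
  also have "\<dots> = real (card (A \<inter> B)) * real K * (real K / real (card B))"
    by (simp add: card_cartesian_product)
  also have "\<dots> \<le> real (card A) * real K * (real K / real (card B))"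
    using A by (intro mult_right_mono) (auto intro: card_mono)
  finally show ?thesis by (simp add: algebra_simps)
qed

text \<open>
  At least half of the weight of \<open>\<Gamma>\<close> avoids \<open>A\<close>, and one set weighs at most \<open>1 / |B|\<close>, so a constant
  multiple of \<open>|B|\<close> sets remain.
\<close>
lemma choose_small_increments:
  assumes B: "finite B" and A: "finite A" and J: "finite J"
    and \<Gamma>: "\<Gamma> \<subseteq> Pow B" "\<And>G. G \<in> \<Gamma> \<Longrightarrow> G \<noteq> {} \<and> card G \<le> K \<and> card G < card B"
    and weight: "(\<Sum>G\<in>\<Gamma>. 1 / real (card B choose card G)) \<ge> c / 2"
    and hit: "real (K * K * card A) \<le> c / 4 * card B"
    and few: "real (card J) \<le> c / 4 * card B"
    and pos: "0 < card B"
  obtains g where "inj_on g J" "g ` J \<subseteq> \<Gamma>" "\<And>j. j \<in> J \<Longrightarrow> g j \<inter> A = {}"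
proof -
  let ?w = "\<lambda>G. 1 / real (card B choose card G)"
  define \<Delta> where "\<Delta> = {G \<in> \<Gamma>. G \<inter> A = {}}"
  have fin: "finite \<Gamma>" using \<Gamma>(1) B by (meson finite_Pow_iff finite_subset)
  have "sum ?w (\<Gamma> - \<Delta>) \<le> (\<Sum>G | G \<subseteq> B \<and> card G \<le> K \<and> G \<inter> A \<noteq> {}. ?w G)"
    using B \<Gamma> by (intro sum_mono2) (auto simp: \<Delta>_def)
  also have "\<dots> \<le> real (K * K * card A) / real (card B)"
    by (rule weight_of_sets_hitting[OF B A])
  also have "\<dots> \<le> c / 4" using hit pos by (simp add: divide_le_eq)
  finally have "c / 4 \<le> sum ?w \<Delta>"
    using weight fin sum.subset_diff[of \<Delta> \<Gamma> ?w] by (simp add: \<Delta>_def)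
  also have "\<dots> \<le> (\<Sum>G\<in>\<Delta>. 1 / real (card B))"
  proof (rule sum_mono)
    fix G assume "G \<in> \<Delta>"
    then have G: "G \<in> \<Gamma>" by (simp add: \<Delta>_def)
    then have "finite G" using \<Gamma>(1) B by (auto intro: finite_subset)
    then have "1 \<le> card G" using \<Gamma>(2)[OF G] by (simp add: Suc_le_eq card_gt_0_iff)
    then show "?w G \<le> 1 / real (card B)"
      using binomial_inverse_le[of 1 "card G" "card B"] \<Gamma>(2)[OF G] by simp
  qed
  finally have "c / 4 * card B \<le> card \<Delta>" using pos by (simp add: field_simps)
  then have "card J \<le> card \<Delta>" using few by linarith
  moreover have "finite \<Delta>" using fin by (simp add: \<Delta>_def)
  ultimately obtain g where g: "inj_on g J" "g ` J \<subseteq> \<Delta>"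
    using card_le_inj[of J \<Delta>] J by auto
  show thesis
  proof (rule that[OF g(1)])
    show "g ` J \<subseteq> \<Gamma>" using g(2) by (auto simp: \<Delta>_def)
    show "g j \<inter> A = {}" if "j \<in> J" for j using g(2) that by (auto simp: \<Delta>_def)
  qed
qed

text \<open>
  Beyond a gap \<open>K\<close> a single set has so little weight that a polynomially large collection \<open>\<Phi>\<close>
  cannot exhaust \<open>\<Gamma>\<close>.
\<close>
lemma choose_large_increment:
  assumes B: "finite B" and \<Gamma>: "\<Gamma> \<subseteq> Pow B"
    and gap: "\<And>G. G \<in> \<Gamma> \<Longrightarrow> K < card G \<and> card G + K < card B"
    and weight: "(\<Sum>G\<in>\<Gamma>. 1 / real (card B choose card G)) \<ge> c / 2"
    and \<Phi>: "finite \<Phi>" "real (card \<Phi>) * (real (K + 1) / real (card B)) ^ (K + 1) < c / 2"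
  shows "\<exists>G\<in>\<Gamma>. G \<notin> \<Phi>"
proof (rule ccontr)
  assume "\<not> ?thesis"
  then have sub: "\<Gamma> \<subseteq> \<Phi>" by blast
  have "(\<Sum>G\<in>\<Gamma>. 1 / real (card B choose card G)) \<le> (\<Sum>G\<in>\<Gamma>. (real (K + 1) / real (card B)) ^ (K + 1))"
  proof (intro sum_mono binomial_inverse_le)
    fix G assume "G \<in> \<Gamma>"
    then show "K + 1 \<le> card G" "card G + (K + 1) \<le> card B" using gap[of G] by auto
  qed simp
  also have "\<dots> = real (card \<Gamma>) * (real (K + 1) / real (card B)) ^ (K + 1)"
    by simp
  also have "\<dots> \<le> real (card \<Phi>) * (real (K + 1) / real (card B)) ^ (K + 1)"
    using card_mono[OF \<Phi>(1) sub] by (intro mult_right_mono) auto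
  finally show False using weight \<Phi>(2) by linarith
qed

text \<open>
  A difference of at most \<open>r\<close> points can be written as a word of length \<open>r\<close> over \<open>X\<close> and one
  padding symbol.
\<close>
lemma card_hamming_ball:
  assumes X: "finite X" and y: "y \<subseteq> X"
  shows "finite {w. w \<subseteq> X \<and> card (sym_diff w y) \<le> r}"
    and "card {w. w \<subseteq> X \<and> card (sym_diff w y) \<le> r} \<le> (card X + 1) ^ r"
proof -
  define W where "W = {w. w \<subseteq> X \<and> card (sym_diff w y) \<le> r}"
  define L where "L = {xs. set xs \<subseteq> insert None (Some ` X) \<and> length xs = r}"
  define f where "f xs = sym_diff y {x. Some x \<in> set xs}" for xs
  have sub: "W \<subseteq> f ` L"
  proof
    fix w assume "w \<in> W"
    then have w: "w \<subseteq> X" "card (sym_diff w y) \<le> r" by (auto simp: W_def)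
    have fin: "finite (sym_diff w y)"
      using w(1) y X by (meson finite_Diff finite_UnI finite_subset)
    then obtain xs where xs: "set xs = sym_diff w y" "distinct xs"
      using finite_distinct_list[OF fin] that by metis
    have len: "length xs \<le> r" using w(2) unfolding xs(1)[symmetric] distinct_card[OF xs(2)] .
    let ?ys = "map Some xs @ replicate (r - length xs) None"
    have "{x. Some x \<in> set ?ys} = set xs" by auto
    then have "f ?ys = sym_diff y (sym_diff w y)"
      by (simp only: f_def xs(1))
    also have "\<dots> = w" by (rule set_eqI) auto
    finally have eq: "w = f ?ys" ..
    have "set xs \<subseteq> X" unfolding xs(1) using w y by (simp add: subset_iff)
    then have "Some ` set xs \<union> {None} \<subseteq> insert None (Some ` X)" by (simp add: image_mono subset_insertI2)
    moreover have "set ?ys \<subseteq> Some ` set xs \<union> {None}"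
      by (simp add: set_replicate_conv_if subset_insertI)
    ultimately have "set ?ys \<subseteq> insert None (Some ` X)" by (rule order.trans[rotated])
    then have "?ys \<in> L" using len by (simp add: L_def)
    then show "w \<in> f ` L" using eq by (rule rev_image_eqI)
  qed
  have fin: "finite L" unfolding L_def using X by (intro finite_lists_length_eq) simp
  have "finite W" using finite_subset[OF sub] fin by simp
  then show "finite {w. w \<subseteq> X \<and> card (sym_diff w y) \<le> r}" by (simp only: W_def)
  have "card W \<le> card L" using fin sub by (rule surj_card_le)
  also have "card L = card (insert None (Some ` X)) ^ r"
    unfolding L_def using X by (intro card_lists_length_eq) simp
  also have "card (insert None (Some ` X)) = card X + 1"
    using X by (simp add: card_image image_iff)
  finally show "card {w. w \<subseteq> X \<and> card (sym_diff w y) \<le> r} \<le> (card X + 1) ^ r"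
    by (simp only: W_def)
qed

section \<open>Separated embeddings\<close>

text \<open>
  The invariant of the embedding. The set \<open>A p\<close> consists of the elements reserved by the node
  \<open>p\<close>: later steps of small gap that start from \<open>p\<close>, or from nodes reached from it by such steps,
  may not use them. Two nodes are either so far apart that the remaining small steps cannot bring
  their descendants together, or they differ in an element that neither of them will change.
\<close>
definition separated :: "nat \<Rightarrow> 'i set \<Rightarrow> ('i \<Rightarrow> 'b set) \<Rightarrow> ('i \<Rightarrow> 'b set) \<Rightarrow> bool" where
  "separated R I \<iota> A \<longleftrightarrow> (\<forall>p\<in>I. \<forall>q\<in>I. p \<noteq> q \<longrightarrow>
     2 * R < card (sym_diff (\<iota> p) (\<iota> q)) \<or> sym_diff (\<iota> p) (\<iota> q) \<inter> (A p \<inter> A q) \<noteq> {})"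

lemma separated_inj_on: "separated R I \<iota> A \<Longrightarrow> inj_on \<iota> I"
  unfolding separated_def inj_on_def by fastforce

text \<open>
  The new set at \<open>q\<close> arises from the old set at the node \<open>b q\<close> by the increment \<open>h q\<close>; old nodes
  have \<open>b q = q\<close> and an empty increment. Distances shrink by at most \<open>2K\<close>. A reserved
  difference of two old nodes survives, because increments avoid the reservations. Children of the same
  node, and the node itself, are separated by the increments, which become reserved.
\<close>
lemma separated_extend_small:
  assumes sep: "separated (R + K) I \<iota> A" and fin: "\<And>p. p \<in> I \<Longrightarrow> finite (\<iota> p)"
    and b: "\<And>q. q \<in> Q \<Longrightarrow> b q \<in> I"
    and h: "\<And>q. q \<in> Q \<Longrightarrow> finite (h q) \<and> card (h q) \<le> K \<and> h q \<inter> A (b q) = {}"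
    and dist: "\<And>q r. \<lbrakk>q \<in> Q; r \<in> Q; q \<noteq> r; b q = b r\<rbrakk> \<Longrightarrow> h q \<noteq> h r"
    and A': "\<And>q. q \<in> Q \<Longrightarrow> A (b q) \<subseteq> A' q"
      "\<And>q r. \<lbrakk>q \<in> Q; r \<in> Q; b q = b r\<rbrakk> \<Longrightarrow> h r \<subseteq> A' q"
  shows "separated R Q (\<lambda>q. sym_diff (\<iota> (b q)) (h q)) A'"
  unfolding separated_def
proof (intro ballI impI)
  fix q r assume q: "q \<in> Q" and r: "r \<in> Q" and ne: "q \<noteq> r"
  let ?v = "\<iota> (b q)" and ?w = "\<iota> (b r)"
  let ?D = "sym_diff (sym_diff ?v (h q)) (sym_diff ?w (h r))"
  show "2 * R < card ?D \<or> ?D \<inter> (A' q \<inter> A' r) \<noteq> {}"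
  proof (cases "b q = b r")
    case True
    have "h q \<subseteq> A' q" "h q \<subseteq> A' r" "h r \<subseteq> A' q" "h r \<subseteq> A' r"
      using A'(2) q r True by auto
    moreover have "h q \<noteq> h r" using dist q r ne True by blast
    then obtain x where x: "x \<in> sym_diff (h q) (h r)" by auto
    moreover have "x \<in> ?D" using x unfolding True by (cases "x \<in> ?w") auto
    ultimately have "x \<in> ?D \<inter> (A' q \<inter> A' r)" by auto
    then show ?thesis unfolding ex_in_conv[symmetric] by metis
  next
    case False
    have "2 * (R + K) < card (sym_diff ?v ?w) \<or> sym_diff ?v ?w \<inter> (A (b q) \<inter> A (b r)) \<noteq> {}"
      by (rule sep[unfolded separated_def, rule_format, OF b[OF q] b[OF r] False])
    then show ?thesis
    proof (elim disjE)
      assume far: "2 * (R + K) < card (sym_diff ?v ?w)"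
      have f: "finite ?v" "finite ?w" "finite (h q)" "finite (h r)"
        using fin b h q r by simp_all
      have "x \<in> ?D \<union> (h q \<union> h r)" if "x \<in> sym_diff ?v ?w" for x
        using that by (cases "x \<in> h q"; cases "x \<in> h r") auto
      then have "sym_diff ?v ?w \<subseteq> ?D \<union> (h q \<union> h r)" by (rule subsetI)
      then have "card (sym_diff ?v ?w) \<le> card (?D \<union> (h q \<union> h r))"
        using f by (intro card_mono) simp_all
      also have "\<dots> \<le> card ?D + (card (h q) + card (h r))"
        by (meson add_left_mono card_Un_le order.trans)
      also have "\<dots> \<le> card ?D + (K + K)"
        using h[OF q] h[OF r] by (intro add_mono) auto
      finally have near: "card (sym_diff ?v ?w) \<le> card ?D + (K + K)" .
      have "2 * R < e" if "2 * (R + K) < a" "a \<le> e + (K + K)" for a e :: nat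
        using that by simp
      then have "2 * R < card ?D" using far near .
      then show ?thesis ..
    next
      assume "sym_diff ?v ?w \<inter> (A (b q) \<inter> A (b r)) \<noteq> {}"
      then obtain x where x: "x \<in> sym_diff ?v ?w" "x \<in> A (b q)" "x \<in> A (b r)"
        unfolding ex_in_conv[symmetric] Int_iff by metis
      have "x \<notin> h q" "x \<notin> h r" using h[OF q] h[OF r] x(2,3) by auto
      then have "x \<in> ?D" using x(1) by simp
      moreover have "x \<in> A' q \<inter> A' r" using A'(1)[OF q] A'(1)[OF r] x(2,3) by auto
      ultimately show ?thesis unfolding ex_in_conv[symmetric] by (metis IntI)
    qed
  qed
qed

text \<open>
  The new nodes are placed one after another, each far from everything placed before.
\<close>
lemma separated_extend_large:
  assumes "finite J" and I: "finite I" "I \<inter> J = {}" and sep: "separated R I \<iota> A"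
    and X: "\<And>p. p \<in> I \<Longrightarrow> \<iota> p \<subseteq> X" "\<And>j. j \<in> J \<Longrightarrow> Cand j \<subseteq> Pow X"
    and far: "\<And>j S. \<lbrakk>j \<in> J; finite S; S \<subseteq> Pow X; card S \<le> M\<rbrakk> \<Longrightarrow>
      \<exists>w\<in>Cand j. \<forall>y\<in>S. 2 * R < card (sym_diff w y)"
    and M: "card I + card J \<le> M"
  shows "\<exists>\<iota>' A'. separated R (I \<union> J) \<iota>' A' \<and> (\<forall>p\<in>I. \<iota>' p = \<iota> p \<and> A' p = A p) \<and>
    (\<forall>j\<in>J. \<iota>' j \<in> Cand j \<and> A' j = {})"
  using \<open>finite J\<close> I(2) X(2) far M
proof (induction J rule: finite_induct)
  case empty
  then show ?case using sep by auto
next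
  case (insert j J)
  have "\<exists>\<iota>' A'. separated R (I \<union> J) \<iota>' A' \<and> (\<forall>p\<in>I. \<iota>' p = \<iota> p \<and> A' p = A p) \<and>
    (\<forall>j\<in>J. \<iota>' j \<in> Cand j \<and> A' j = {})"
  proof (rule insert.IH)
    show "\<exists>w\<in>Cand k. \<forall>y\<in>S. 2 * R < card (sym_diff w y)"
      if "k \<in> J" "finite S" "S \<subseteq> Pow X" "card S \<le> M" for k S
      using that by (intro insert.prems(3)) simp_all
  qed (use insert.prems(1,2,4) insert.hyps in simp_all)
  then obtain \<iota>' A' where IH: "separated R (I \<union> J) \<iota>' A'" "\<forall>p\<in>I. \<iota>' p = \<iota> p \<and> A' p = A p"
    "\<forall>j\<in>J. \<iota>' j \<in> Cand j \<and> A' j = {}" by blast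
  let ?S = "\<iota>' ` (I \<union> J)"
  have fin: "finite (I \<union> J)" using I insert.hyps by simp
  have "card ?S \<le> card (I \<union> J)" using fin by (rule card_image_le)
  also have "\<dots> \<le> card I + card J" by (rule card_Un_le)
  also have "\<dots> \<le> M" using insert.prems(4) insert.hyps by simp
  finally have "card ?S \<le> M" .
  moreover have "\<iota>' p \<subseteq> X" if "p \<in> I \<union> J" for p
  proof (cases "p \<in> I")
    case True
    then show ?thesis using IH(2) X(1) by simp
  next
    case False
    then have "p \<in> J" using that by simp
    then show ?thesis using IH(3) insert.prems(2)[of p] by auto
  qed
  then have "?S \<subseteq> Pow X" by (simp add: image_subset_iff)
  ultimately obtain w where w: "w \<in> Cand j" "\<forall>y\<in>?S. 2 * R < card (sym_diff w y)"
    using insert.prems(3)[of j ?S] fin by (meson finite_imageI insertI1)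
  have j: "j \<notin> I \<union> J" using insert.prems(1) insert.hyps by blast
  have far_w: "2 * R < card (sym_diff w (\<iota>' q))" "2 * R < card (sym_diff (\<iota>' q) w)" if "q \<in> I \<union> J" for q
    using bspec[OF w(2) imageI[OF that]] Un_commute[of "w - \<iota>' q"] by simp_all
  have "separated R (I \<union> insert j J) (\<iota>'(j := w)) (A'(j := {}))"
    unfolding separated_def
  proof (intro ballI impI)
    fix p q assume "p \<in> I \<union> insert j J" "q \<in> I \<union> insert j J" "p \<noteq> q"
    then consider "p = j" "q \<noteq> j" "q \<in> I \<union> J" | "p \<noteq> j" "q = j" "p \<in> I \<union> J"
      | "p \<noteq> j" "q \<noteq> j" "p \<in> I \<union> J" "q \<in> I \<union> J" by blast
    then show "2 * R < card (sym_diff ((\<iota>'(j := w)) p) ((\<iota>'(j := w)) q)) \<or>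
        sym_diff ((\<iota>'(j := w)) p) ((\<iota>'(j := w)) q) \<inter> ((A'(j := {})) p \<inter> (A'(j := {})) q) \<noteq> {}"
    proof cases
      case 1
      then show ?thesis using far_w(1)[of q] by simp
    next
      case 2
      then show ?thesis using far_w(2)[of p] by simp
    next
      case 3
      then show ?thesis using IH(1) \<open>p \<noteq> q\<close> unfolding separated_def by (metis fun_upd_other)
    qed
  qed
  moreover have "\<forall>p\<in>I. (\<iota>'(j := w)) p = \<iota> p \<and> (A'(j := {})) p = A p"
    using IH(2) j by auto
  moreover have "\<forall>k\<in>insert j J. (\<iota>'(j := w)) k \<in> Cand k \<and> (A'(j := {})) k = {}"
    using IH(3) w(1) j by auto
  ultimately show ?case by blast
qed

section \<open>Adding the children of a vertex\<close>

definition increments :: "'b set \<Rightarrow> bool \<Rightarrow> 'b set \<Rightarrow> 'b set set \<Rightarrow> 'b set set" where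
  "increments X up v \<G> = {G. G \<subseteq> room X up v \<and> G \<noteq> {} \<and> sym_diff v G \<in> \<G>}"

lemma sym_diff_cancel: "sym_diff v (sym_diff v w) = w"
  by (rule set_eqI) auto

lemma toward_sym_diff: "\<lbrakk>G \<subseteq> room X up v; G \<noteq> {}\<rbrakk> \<Longrightarrow> toward up v (sym_diff v G)"
  by (cases up) (auto simp: toward_def room_def)

lemma sym_diff_room: "\<lbrakk>toward up v w; w \<subseteq> X\<rbrakk> \<Longrightarrow> sym_diff v w \<subseteq> room X up v \<and> sym_diff v w \<noteq> {}"
  by (cases up) (auto simp: toward_def room_def)

lemma degree_eq_increments:
  assumes "\<G> \<subseteq> Pow X"
  shows "degree X up v \<G> = (\<Sum>G\<in>increments X up v \<G>. 1 / real (card (room X up v) choose card G))"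
  unfolding degree_def
proof (rule sum.reindex_bij_witness[where i = "\<lambda>G. sym_diff v G" and j = "\<lambda>w. sym_diff v w"])
  fix w assume w: "w \<in> {w \<in> \<G>. toward up v w}"
  then have "sym_diff v w \<subseteq> room X up v \<and> sym_diff v w \<noteq> {}"
    using assms by (intro sym_diff_room) auto
  then show "sym_diff v w \<in> increments X up v \<G>"
    using w by (simp only: increments_def mem_Collect_eq sym_diff_cancel simp_thms)
next
  fix G assume "G \<in> increments X up v \<G>"
  then have "G \<subseteq> room X up v" "G \<noteq> {}" "sym_diff v G \<in> \<G>"
    by (simp_all add: increments_def)
  then show "sym_diff v G \<in> {w \<in> \<G>. toward up v w}"
    using toward_sym_diff by (intro CollectI conjI)
qed (simp_all only: sym_diff_cancel)

text \<open>
  In these layers, both the room above and the room below a set are linear in \<open>|X|\<close>, and the same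
  holds for the part of the room that is left after a step into another such set.
\<close>
definition inner :: "'b set \<Rightarrow> 'b set set" where
  "inner X = {w. w \<subseteq> X \<and> card X div 4 \<le> card w \<and> card w + card X div 4 \<le> card X}"

lemma card_room_ge:
  assumes "finite X" "v \<in> inner X"
  shows "card X div 4 \<le> card (room X up v)"
proof -
  have "card (X - v) = card X - card v"
    using assms by (intro card_Diff_subset) (auto simp: inner_def intro: finite_subset)
  then show ?thesis using assms by (cases up) (auto simp: room_def inner_def)
qed

lemma card_increment_le:
  assumes X: "finite X" and v: "v \<in> inner X" and \<G>: "\<G> \<subseteq> inner X" and G: "G \<in> increments X up v \<G>"
  shows "card G + card X div 4 \<le> card (room X up v)"
proof -
  have w: "sym_diff v G \<in> inner X" and GB: "G \<subseteq> room X up v"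
    using \<G> G by (auto simp: increments_def)
  have vX: "v \<subseteq> X" using v by (simp add: inner_def)
  have fin: "finite v" "finite G"
    using X vX GB by (auto simp: room_def intro: finite_subset split: if_splits)
  show ?thesis
  proof (cases up)
    case True
    then have "G \<subseteq> X - v" using GB by (simp add: room_def)
    then have "sym_diff v G = v \<union> G" "v \<inter> G = {}" by auto
    then have "card v + card G + card X div 4 \<le> card X"
      using w fin by (simp add: inner_def card_Un_disjoint)
    moreover have "card (X - v) = card X - card v"
      using fin vX by (intro card_Diff_subset)
    ultimately show ?thesis using True by (simp add: room_def)
  next
    case False
    then have "G \<subseteq> v" using GB by (simp add: room_def)
    moreover from this have "sym_diff v G = v - G" by auto
    ultimately have "card X div 4 \<le> card v - card G" "card G \<le> card v"
      using w fin by (simp_all add: inner_def card_Diff_subset card_mono)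
    then show ?thesis using False by (simp add: room_def)
  qed
qed

text \<open>
  The sets within distance \<open>2R\<close> of \<open>S\<close> lie in at most \<open>M\<close> Hamming balls, which is too few to
  absorb half of the degree when all gaps exceed \<open>K\<close>.
\<close>
lemma far_neighbour_exists:
  assumes X: "finite X" and v: "v \<in> inner X" and \<G>: "\<G> \<subseteq> inner X" and K: "K < card X div 4"
    and weight: "c / 2 \<le> (\<Sum>G | G \<in> increments X up v \<G> \<and> K < card G.
      1 / real (card (room X up v) choose card G))"
    and S: "finite S" "S \<subseteq> Pow X" "card S \<le> M"
    and num: "real (M * (card X + 1) ^ (2 * R)) * (real (K + 1) / real (card X div 4)) ^ (K + 1) < c / 2"
  shows "\<exists>w\<in>{w \<in> \<G>. toward up v w}. \<forall>y\<in>S. 2 * R < card (sym_diff w y)"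
proof -
  define ball where "ball y = {w. w \<subseteq> X \<and> card (sym_diff w y) \<le> 2 * R}" for y
  define \<Phi> where "\<Phi> = (\<lambda>w. sym_diff v w) ` (\<Union>y\<in>S. ball y)"
  define \<Gamma> where "\<Gamma> = {G. G \<in> increments X up v \<G> \<and> K < card G}"
  let ?B = "room X up v"
  have B: "finite ?B" using X v by (auto simp: room_def inner_def intro: finite_subset)
  have ball: "finite (ball y)" "card (ball y) \<le> (card X + 1) ^ (2 * R)" if "y \<in> S" for y
    unfolding ball_def using card_hamming_ball[OF X, of y "2 * R"] S(2) that by auto
  have fin: "finite (\<Union>y\<in>S. ball y)" using S(1) ball(1) by simp
  have "card \<Phi> \<le> card (\<Union>y\<in>S. ball y)"
    unfolding \<Phi>_def by (rule card_image_le[OF fin])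
  also have "\<dots> \<le> (\<Sum>y\<in>S. card (ball y))" by (rule card_UN_le[OF S(1)])
  also have "\<dots> \<le> card S * (card X + 1) ^ (2 * R)"
    using sum_bounded_above[of S "\<lambda>y. card (ball y)"] ball(2) by simp
  also have "\<dots> \<le> M * (card X + 1) ^ (2 * R)" using S(3) by simp
  finally have card\<Phi>: "card \<Phi> \<le> M * (card X + 1) ^ (2 * R)" .
  have "real (card \<Phi>) * (real (K + 1) / real (card ?B)) ^ (K + 1)
      \<le> real (M * (card X + 1) ^ (2 * R)) * (real (K + 1) / real (card X div 4)) ^ (K + 1)"
    using card_room_ge[OF X v, of up] K
    by (intro mult_mono power_mono divide_left_mono of_nat_mono[OF card\<Phi>])
      (auto intro!: mult_pos_pos divide_nonneg_nonneg zero_le_power)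
  then have "real (card \<Phi>) * (real (K + 1) / real (card ?B)) ^ (K + 1) < c / 2"
    using num by linarith
  moreover have "\<Gamma> \<subseteq> Pow ?B" by (auto simp: \<Gamma>_def increments_def)
  moreover have "K < card G \<and> card G + K < card ?B" if "G \<in> \<Gamma>" for G
    using card_increment_le[OF X v \<G>, of G up] that K by (simp add: \<Gamma>_def)
  moreover have "finite \<Phi>" unfolding \<Phi>_def using fin by simp
  ultimately obtain G where G: "G \<in> \<Gamma>" "G \<notin> \<Phi>"
    using choose_large_increment[OF B, of \<Gamma> K c \<Phi>] weight unfolding \<Gamma>_def by blast
  let ?w = "sym_diff v G"
  have w: "?w \<in> \<G>" "toward up v ?w"
    using G(1) toward_sym_diff[of G X up v] by (simp_all add: \<Gamma>_def increments_def)
  then have wX: "?w \<subseteq> X" using \<G> by (auto simp: inner_def)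
  have "2 * R < card (sym_diff ?w y)" if y: "y \<in> S" for y
  proof (rule ccontr)
    assume "\<not> ?thesis"
    then have "?w \<in> ball y" using wX by (simp add: ball_def)
    then have "?w \<in> (\<Union>y\<in>S. ball y)" using y by (rule UN_I[rotated])
    then have "sym_diff v ?w \<in> \<Phi>" unfolding \<Phi>_def by (rule imageI)
    then show False using G(2) by (simp only: sym_diff_cancel)
  qed
  then show ?thesis using w by (intro bexI[of _ ?w]) simp_all
qed

lemma near_neighbours_exist:
  assumes X: "finite X" and v: "v \<in> inner X" and \<G>: "\<G> \<subseteq> inner X" and K: "K < card X div 4"
    and weight: "c / 2 \<le> (\<Sum>G | G \<in> increments X up v \<G> \<and> card G \<le> K.
      1 / real (card (room X up v) choose card G))"
    and A: "finite A" "real (K * K * card A) \<le> c / 4 * real (card X div 4)"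
    and J: "finite J" "real (card J) \<le> c / 4 * real (card X div 4)"
    and c: "0 < c"
  obtains g where "inj_on g J"
    "\<And>j. j \<in> J \<Longrightarrow> g j \<in> increments X up v \<G> \<and> card (g j) \<le> K \<and> g j \<inter> A = {}"
proof -
  let ?B = "room X up v" and ?\<Gamma> = "{G. G \<in> increments X up v \<G> \<and> card G \<le> K}"
  have B: "finite ?B" using X v by (auto simp: room_def inner_def intro: finite_subset)
  have N: "c / 4 * real (card X div 4) \<le> c / 4 * real (card ?B)"
    using card_room_ge[OF X v, of up] c by (intro mult_left_mono) auto
  obtain g where g: "inj_on g J" "g ` J \<subseteq> ?\<Gamma>" "\<And>j. j \<in> J \<Longrightarrow> g j \<inter> A = {}"
  proof (rule choose_small_increments[OF B A(1) J(1), of ?\<Gamma> K c])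
    show "?\<Gamma> \<subseteq> Pow ?B" by (auto simp: increments_def)
    show "G \<noteq> {} \<and> card G \<le> K \<and> card G < card ?B" if "G \<in> ?\<Gamma>" for G
      using card_increment_le[OF X v \<G>, of G up] that K by (auto simp: increments_def)
    show "0 < card ?B" using card_room_ge[OF X v, of up] K by simp
  qed (use weight A(2) J(2) N in auto)
  show thesis
    using that[OF g(1)] g(2,3) by (simp add: image_subset_iff)
qed

text \<open>
  One stage of the embedding: the children \<open>J\<close> of nodes \<open>p\<close> from \<open>I\<close> are placed in the pool
  \<open>\<G>\<close>. The children of nodes for which the small gaps carry half of the degree are placed first, since
  this costs \<open>K\<close> of the separation radius; the other children are then placed at distance more
  than \<open>2R\<close> from all of them.
\<close>
lemma add_children:
  fixes \<iota> :: "'i \<Rightarrow> 'b set" and par :: "'i \<Rightarrow> 'i"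
  assumes X: "finite X" and sep: "separated (R + K) I \<iota> A"
    and IJ: "finite I" "finite J" "I \<inter> J = {}" "card I + card J \<le> M"
    and par: "\<And>j. j \<in> J \<Longrightarrow> par j \<in> I" "\<And>p. card {j \<in> J. par j = p} \<le> d"
    and \<iota>: "\<And>p. p \<in> I \<Longrightarrow> \<iota> p \<in> inner X"
    and A: "\<And>p. p \<in> I \<Longrightarrow> finite (A p) \<and> card (A p) \<le> b"
    and \<G>: "\<G> \<subseteq> inner X"
    and deg: "\<And>j. j \<in> J \<Longrightarrow> c \<le> degree X up (\<iota> (par j)) \<G>" and c: "0 < c"
    and K: "K < card X div 4"
    and room_b: "real (K * K * b) \<le> c / 4 * real (card X div 4)"
    and room_d: "real d \<le> c / 4 * real (card X div 4)"
    and room_M: "real (M * (card X + 1) ^ (2 * R)) * (real (K + 1) / real (card X div 4)) ^ (K + 1) < c / 2"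
  shows "\<exists>\<iota>' A'. separated R (I \<union> J) \<iota>' A' \<and> (\<forall>p\<in>I. \<iota>' p = \<iota> p) \<and>
    (\<forall>j\<in>J. \<iota>' j \<in> \<G> \<and> toward up (\<iota> (par j)) (\<iota>' j)) \<and>
    (\<forall>q\<in>I \<union> J. finite (A' q) \<and> card (A' q) \<le> b + d * K)"
proof -
  let ?w = "\<lambda>p G. 1 / real (card (room X up (\<iota> p)) choose card G)"
  let ?\<Gamma> = "\<lambda>p. increments X up (\<iota> p) \<G>"
  define small where "small p \<longleftrightarrow> c / 2 \<le> (\<Sum>G | G \<in> ?\<Gamma> p \<and> card G \<le> K. ?w p G)" for p
  define Js where "Js = {j \<in> J. small (par j)}"
  define Jl where "Jl = {j \<in> J. \<not> small (par j)}"
  have Jsl: "J = Js \<union> Jl" "Js \<inter> Jl = {}" "finite Js" "finite Jl"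
    using IJ(2) by (auto simp: Js_def Jl_def)
  have subX: "\<iota> p \<subseteq> X" if "p \<in> I" for p using \<iota>[OF that] by (simp add: inner_def)
  have fin\<iota>: "finite (\<iota> p)" if "p \<in> I" for p using subX[OF that] X by (rule finite_subset)
  have large: "c / 2 \<le> (\<Sum>G | G \<in> ?\<Gamma> (par j) \<and> K < card G. ?w (par j) G)" if j: "j \<in> Jl" for j
  proof -
    let ?p = "par j"
    have "finite (room X up (\<iota> ?p))"
      using X fin\<iota>[OF par(1)] j by (simp add: room_def Jl_def)
    then have fin: "finite (?\<Gamma> ?p)"
      by (rule finite_subset[rotated, OF finite_Pow_iff[THEN iffD2]]) (auto simp: increments_def)
    have "c \<le> degree X up (\<iota> ?p) \<G>" using j by (intro deg) (simp add: Jl_def)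
    also have "\<dots> = (\<Sum>G\<in>?\<Gamma> ?p. ?w ?p G)"
      using \<G> by (intro degree_eq_increments) (auto simp: inner_def)
    also have "?\<Gamma> ?p = {G. G \<in> ?\<Gamma> ?p \<and> card G \<le> K} \<union> {G. G \<in> ?\<Gamma> ?p \<and> K < card G}"
      by auto
    also have "(\<Sum>G\<in>\<dots>. ?w ?p G) = (\<Sum>G | G \<in> ?\<Gamma> ?p \<and> card G \<le> K. ?w ?p G)
        + (\<Sum>G | G \<in> ?\<Gamma> ?p \<and> K < card G. ?w ?p G)"
      using fin by (intro sum.union_disjoint) auto
    finally show ?thesis using j by (simp add: Jl_def small_def)
  qed
  have "\<exists>g. inj_on g {j \<in> Js. par j = p} \<and>
      (\<forall>j\<in>{j \<in> Js. par j = p}. g j \<in> ?\<Gamma> p \<and> card (g j) \<le> K \<and> g j \<inter> A p = {})"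
    if "p \<in> par ` Js" for p
  proof -
    have p: "p \<in> I" "small p" using that par(1) by (auto simp: Js_def)
    have "real (K * K * card (A p)) \<le> real (K * K * b)"
      using A[OF p(1)] by (intro of_nat_mono mult_left_mono) auto
    then have hit: "real (K * K * card (A p)) \<le> c / 4 * real (card X div 4)"
      using room_b by linarith
    have "card {j \<in> Js. par j = p} \<le> card {j \<in> J. par j = p}"
      using IJ(2) by (intro card_mono) (auto simp: Js_def)
    then have "real (card {j \<in> Js. par j = p}) \<le> real d"
      using par(2)[of p] by simp
    then have few: "real (card {j \<in> Js. par j = p}) \<le> c / 4 * real (card X div 4)"
      using room_d by linarith
    have "finite {j \<in> Js. par j = p}" using Jsl(3) by simp
    then obtain g where g: "inj_on g {j \<in> Js. par j = p}"
      "\<And>j. j \<in> {j \<in> Js. par j = p} \<Longrightarrow> g j \<in> ?\<Gamma> p \<and> card (g j) \<le> K \<and> g j \<inter> A p = {}"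
      using near_neighbours_exist[OF X \<iota>[OF p(1)] \<G> K p(2)[unfolded small_def]
          conjunct1[OF A[OF p(1)]] hit _ few c] by (metis (lifting))
    show ?thesis
      by (intro exI[of _ g] conjI ballI) (use g in simp_all)
  qed
  then have "\<forall>p\<in>par ` Js. \<exists>g. inj_on g {j \<in> Js. par j = p} \<and>
      (\<forall>j\<in>{j \<in> Js. par j = p}. g j \<in> ?\<Gamma> p \<and> card (g j) \<le> K \<and> g j \<inter> A p = {})"
    by (rule ballI)
  from bchoice[OF this] obtain g0 where "\<forall>p\<in>par ` Js. inj_on (g0 p) {j \<in> Js. par j = p} \<and>
      (\<forall>j\<in>{j \<in> Js. par j = p}. g0 p j \<in> ?\<Gamma> p \<and> card (g0 p j) \<le> K \<and> g0 p j \<inter> A p = {})"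
    by (rule exE)
  note g0 = bspec[OF this]
  define g where "g j = g0 (par j) j" for j
  have g: "g j \<in> ?\<Gamma> (par j)" "card (g j) \<le> K" "g j \<inter> A (par j) = {}" if "j \<in> Js" for j
    using g0[OF imageI[OF that]] that by (simp_all add: g_def)
  have g_inj: "g j \<noteq> g k" if "j \<in> Js" "k \<in> Js" "j \<noteq> k" "par j = par k" for j k
  proof -
    have "inj_on (g0 (par k)) {i \<in> Js. par i = par k}" using g0[OF imageI[OF that(2)]] by (rule conjunct1)
    from inj_on_contraD[OF this that(3)] show ?thesis using that by (simp add: g_def)
  qed
  have g_fin: "finite (g j)" "g j \<noteq> {}" if "j \<in> Js" for j
  proof -
    have "g j \<subseteq> room X up (\<iota> (par j))" "g j \<noteq> {}"
      using g(1)[OF that] by (auto simp: increments_def)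
    moreover have "finite (room X up (\<iota> (par j)))"
      using X fin\<iota>[OF par(1)] that by (simp add: room_def Js_def)
    ultimately show "finite (g j)" "g j \<noteq> {}" by (auto intro: finite_subset)
  qed
  \<comment> \<open>The data for one application of the small extension step to the old nodes and the new ones in \<open>Js\<close>.\<close>
  define b' where "b' q = (if q \<in> Js then par q else q)" for q
  define h where "h q = (if q \<in> Js then g q else {})" for q
  define A1 where "A1 q = A (b' q) \<union> (\<Union>j\<in>{j \<in> Js. par j = b' q}. g j)" for q
  define \<iota>1 where "\<iota>1 q = sym_diff (\<iota> (b' q)) (h q)" for q
  have b'I: "b' q \<in> I" if "q \<in> I \<union> Js" for q
    using that par(1) IJ(3) by (auto simp: b'_def Js_def)
  have sep1: "separated R (I \<union> Js) \<iota>1 A1"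
    unfolding \<iota>1_def
  proof (rule separated_extend_small[OF sep fin\<iota> b'I])
    show "finite (h q) \<and> card (h q) \<le> K \<and> h q \<inter> A (b' q) = {}" for q
      using g g_fin by (simp add: h_def b'_def)
    show "h q \<noteq> h r" if "q \<noteq> r" "b' q = b' r" for q r
      using that g_inj[of q r] g_fin(2)[of q] g_fin(2)[of r]
      by (cases "q \<in> Js"; cases "r \<in> Js") (auto simp: h_def b'_def)
    show "A (b' q) \<subseteq> A1 q" for q by (simp add: A1_def)
    show "h r \<subseteq> A1 q" if "b' q = b' r" for q r
    proof (cases "r \<in> Js")
      case True
      then have "r \<in> {j \<in> Js. par j = b' q}" using that by (simp add: b'_def)
      then show ?thesis unfolding A1_def h_def using True by auto
    qed (simp add: h_def)
  qed
  have A1: "finite (A1 q) \<and> card (A1 q) \<le> b + d * K" if q: "q \<in> I \<union> Js" for q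
  proof -
    let ?C = "{j \<in> Js. par j = b' q}"
    have "finite ?C" using Jsl(3) by simp
    then have "card (\<Union>j\<in>?C. g j) \<le> (\<Sum>j\<in>?C. card (g j))" by (rule card_UN_le)
    also have "\<dots> \<le> card ?C * K" using sum_bounded_above[of ?C "\<lambda>j. card (g j)"] g(2) by simp
    also have "card ?C \<le> card {j \<in> J. par j = b' q}"
      using IJ(2) by (intro card_mono) (auto simp: Js_def)
    then have "card ?C * K \<le> d * K" using par(2)[of "b' q"] by (intro mult_right_mono) auto
    finally have "card (\<Union>j\<in>?C. g j) \<le> d * K" .
    moreover have "finite (A (b' q))" "card (A (b' q)) \<le> b" using A[OF b'I[OF q]] by auto
    ultimately have "card (A1 q) \<le> b + d * K"
      unfolding A1_def by (meson add_mono card_Un_le order.trans)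
    moreover have "finite (A1 q)"
      unfolding A1_def using \<open>finite (A (b' q))\<close> Jsl(3) g_fin(1) by simp
    ultimately show ?thesis by simp
  qed
  have \<iota>1I: "\<iota>1 p = \<iota> p" if "p \<in> I" for p
  proof -
    have "p \<notin> Js" using that IJ(3) by (auto simp: Js_def)
    then show ?thesis by (simp add: \<iota>1_def b'_def h_def)
  qed
  have \<iota>1J: "\<iota>1 j \<in> \<G> \<and> toward up (\<iota> (par j)) (\<iota>1 j)" if "j \<in> Js" for j
  proof -
    have "\<iota>1 j = sym_diff (\<iota> (par j)) (g j)" using that by (simp add: \<iota>1_def b'_def h_def)
    then show ?thesis
      using g(1)[OF that] toward_sym_diff[of "g j" X up "\<iota> (par j)"] by (simp add: increments_def)
  qed
  have "\<exists>\<iota>' A'. separated R ((I \<union> Js) \<union> Jl) \<iota>' A' \<and>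
      (\<forall>p\<in>I \<union> Js. \<iota>' p = \<iota>1 p \<and> A' p = A1 p) \<and>
      (\<forall>j\<in>Jl. \<iota>' j \<in> {w \<in> \<G>. toward up (\<iota> (par j)) w} \<and> A' j = {})"
  proof (rule separated_extend_large[OF Jsl(4) _ _ sep1, where X = X and M = M])
    show "finite (I \<union> Js)" using IJ(1) Jsl(3) by simp
    show "(I \<union> Js) \<inter> Jl = {}" using IJ(3) by (auto simp: Js_def Jl_def)
    show "\<iota>1 p \<subseteq> X" if "p \<in> I \<union> Js" for p
    proof (cases "p \<in> I")
      case True
      then show ?thesis using \<iota>1I subX by simp
    next
      case False
      then have "\<iota>1 p \<in> inner X" using \<iota>1J[of p] \<G> that by auto
      then show ?thesis by (simp add: inner_def)
    qed
    show "{w \<in> \<G>. toward up (\<iota> (par j)) w} \<subseteq> Pow X" for j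
      using \<G> by (auto simp: inner_def)
    show "\<exists>w\<in>{w \<in> \<G>. toward up (\<iota> (par j)) w}. \<forall>y\<in>S. 2 * R < card (sym_diff w y)"
      if "j \<in> Jl" "finite S" "S \<subseteq> Pow X" "card S \<le> M" for j S
      using that par(1)[of j]
      by (intro far_neighbour_exists[OF X \<iota> \<G> K large _ _ _ room_M]) (auto simp: Jl_def)
    have "card (I \<union> Js) + card Jl \<le> card I + (card Js + card Jl)"
      using card_Un_le[of I Js] by simp
    also have "card Js + card Jl = card J"
      using Jsl by (metis card_Un_disjoint)
    finally show "card (I \<union> Js) + card Jl \<le> M" using IJ(4) by simp
  qed
  then obtain \<iota>' A' where *: "separated R ((I \<union> Js) \<union> Jl) \<iota>' A'"
    "\<forall>p\<in>I \<union> Js. \<iota>' p = \<iota>1 p \<and> A' p = A1 p"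
    "\<forall>j\<in>Jl. \<iota>' j \<in> {w \<in> \<G>. toward up (\<iota> (par j)) w} \<and> A' j = {}" by blast
  have "separated R (I \<union> J) \<iota>' A'" using *(1) Jsl(1) by (simp add: Un_assoc)
  moreover have "\<forall>p\<in>I. \<iota>' p = \<iota> p" using *(2) \<iota>1I by simp
  moreover have "\<forall>j\<in>J. \<iota>' j \<in> \<G> \<and> toward up (\<iota> (par j)) (\<iota>' j)"
    using *(2,3) \<iota>1J Jsl(1) by auto
  moreover have "\<forall>q\<in>I \<union> J. finite (A' q) \<and> card (A' q) \<le> b + d * K"
    using *(2,3) A1 Jsl(1) by auto
  ultimately show ?thesis by blast
qed

section \<open>Embedding a rooted tree\<close>

lemma quarter_ge: "8 \<le> n \<Longrightarrow> real n / 8 \<le> real (n div 4)"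
proof -
  assume "8 \<le> n"
  moreover have "n < 4 * (n div 4) + 4" using dividend_less_times_div[of 4 n] by simp
  ultimately have "n \<le> 8 * (n div 4)" by linarith
  then have "real n \<le> real (8 * (n div 4))" by (rule of_nat_mono)
  then show ?thesis by simp
qed

text \<open>
  Gaps above \<open>K = D + 2R\<close> beat the \<open>n ^ D\<close> nodes times the \<open>(n + 1) ^ (2R)\<close> sets in a ball by one
  factor of \<open>n\<close>.
\<close>
lemma ball_weight_small:
  fixes v D R :: nat
  assumes c: "0 < c"
  shows "\<exists>N. \<forall>n\<ge>N. real (v * n ^ D * (n + 1) ^ (2 * R)) *
    (real (D + 2 * R + 1) / real (n div 4)) ^ (D + 2 * R + 1) < c / 2"
proof -
  let ?K = "D + 2 * R"
  define C where "C = real v * 2 ^ (2 * R) * (8 * real (?K + 1)) ^ (?K + 1)"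
  have C0: "0 \<le> C" by (simp add: C_def)
  show ?thesis
  proof (intro exI allI impI)
    fix n assume n: "max 8 (nat \<lceil>2 * C / c\<rceil> + 1) \<le> n"
    then have n8: "8 \<le> n" by simp
    then have n0: "0 < real n" by simp
    have "2 * C / c < real n" using n by linarith
    then have small: "C / real n < c / 2" using c n0 by (simp add: field_simps)
    have "real (v * n ^ D * (n + 1) ^ (2 * R)) = real v * real n ^ D * (real n + 1) ^ (2 * R)"
      by (simp add: add.commute)
    also have "\<dots> \<le> real v * real n ^ D * (2 * real n) ^ (2 * R)"
      using n8 by (intro mult_left_mono power_mono) auto
    finally have 1: "real (v * n ^ D * (n + 1) ^ (2 * R)) \<le> real v * real n ^ D * (2 * real n) ^ (2 * R)" .
    have "real (?K + 1) / real (n div 4) \<le> real (?K + 1) / (real n / 8)"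
      using quarter_ge[OF n8] n0 by (intro divide_left_mono) auto
    also have "\<dots> = 8 * real (?K + 1) / real n" by simp
    finally have 2: "(real (?K + 1) / real (n div 4)) ^ (?K + 1) \<le> (8 * real (?K + 1) / real n) ^ (?K + 1)"
      by (intro power_mono) auto
    have "real (v * n ^ D * (n + 1) ^ (2 * R)) * (real (?K + 1) / real (n div 4)) ^ (?K + 1)
        \<le> (real v * real n ^ D * (2 * real n) ^ (2 * R)) * (8 * real (?K + 1) / real n) ^ (?K + 1)"
      using 1 2 by (rule mult_mono) auto
    also have "\<dots> = C * (real n ^ ?K / real n ^ (?K + 1))"
      by (simp add: C_def power_divide power_mult_distrib power_add)
    also have "real n ^ ?K / real n ^ (?K + 1) = 1 / real n"
      using n0 by simp
    also have "C * (1 / real n) = C / real n" by simp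
    finally show "real (v * n ^ D * (n + 1) ^ (2 * R)) * (real (?K + 1) / real (n div 4)) ^ (?K + 1) < c / 2"
      using small by (rule le_less_trans)
  qed
qed

text \<open>
  The elements of the blow-up of a rooted tree; the parent of the copy \<open>(u, i)\<close> is
  \<open>(par u, i div d)\<close>.
\<close>
definition copies :: "('a \<Rightarrow> nat) \<Rightarrow> nat \<Rightarrow> 'a set \<Rightarrow> ('a \<times> nat) set" where
  "copies depth d S = {(u, i). u \<in> S \<and> i < d ^ depth u}"

lemma copies_Sigma: "copies depth d S = (SIGMA u:S. {..<d ^ depth u})"
  by (auto simp: copies_def)

lemma card_copies_le:
  assumes "finite S" "\<And>u. u \<in> S \<Longrightarrow> depth u \<le> D" "d \<le> n" "0 < n"
  shows "finite (copies depth d S)" "card (copies depth d S) \<le> card S * n ^ D"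
proof -
  show "finite (copies depth d S)" using assms(1) by (simp add: copies_Sigma)
  have "card (copies depth d S) = (\<Sum>u\<in>S. d ^ depth u)"
    using assms(1) by (simp add: copies_Sigma)
  also have "\<dots> \<le> (\<Sum>u\<in>S. n ^ D)"
  proof (rule sum_mono)
    fix u assume "u \<in> S"
    have "d ^ depth u \<le> n ^ depth u" using assms(3) by (rule power_mono) simp
    also have "\<dots> \<le> n ^ D" using assms(2)[OF \<open>u \<in> S\<close>] assms(4) by (intro power_increasing) auto
    finally show "d ^ depth u \<le> n ^ D" .
  qed
  finally show "card (copies depth d S) \<le> card S * n ^ D" by simp
qed

definition embeds :: "('a \<Rightarrow> 'a) \<Rightarrow> 'a \<Rightarrow> ('a \<Rightarrow> bool) \<Rightarrow> ('a \<Rightarrow> 'b set set) \<Rightarrow> nat \<Rightarrow>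
    ('a \<times> nat) set \<Rightarrow> ('a \<times> nat \<Rightarrow> 'b set) \<Rightarrow> bool" where
  "embeds par x up pool d I \<iota> \<longleftrightarrow> (\<forall>(u, i)\<in>I. \<iota> (u, i) \<in> pool u \<and>
     (u \<noteq> x \<longrightarrow> toward (up u) (\<iota> (par u, i div d)) (\<iota> (u, i))))"

lemma embedsD:
  assumes "embeds par x up pool d I \<iota>" "(u, i) \<in> I"
  shows "\<iota> (u, i) \<in> pool u" "u \<noteq> x \<Longrightarrow> toward (up u) (\<iota> (par u, i div d)) (\<iota> (u, i))"
  using assms unfolding embeds_def by auto

text \<open>
  Induction on the parent-closed part \<open>S\<close> of the tree that is already embedded, for all radii \<open>R\<close> at
  once: a vertex \<open>u\<close> of maximal depth is split off, and the rest is embedded with the larger radius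
  \<open>R + K\<close>. The reservations grow to at most \<open>b d\<close> elements, which is a small fraction of \<open>n\<close> if
  \<open>\<delta>\<close> is small in terms of \<open>b\<close>.
\<close>
lemma rooted_tree_embedding:
  fixes depth :: "'a \<Rightarrow> nat" and up :: "'a \<Rightarrow> bool"
  assumes V: "finite V" "x \<in> V" and root: "depth x = 0"
    and step: "\<forall>u\<in>V - {x}. par u \<in> V \<and> depth u = Suc (depth (par u))"
    and c: "0 < c"
    and S: "S \<subseteq> V" "x \<in> S" "\<forall>u\<in>S - {x}. par u \<in> S"
  shows "\<exists>\<delta>>0. \<exists>N b. \<forall>(X :: 'b set) pool d.
    finite X \<and> N \<le> card X \<and> real d \<le> \<delta> * real (card X) \<and>
    (\<forall>u\<in>V. pool u \<subseteq> inner X) \<and> pool x \<noteq> {} \<and>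
    (\<forall>u\<in>V - {x}. \<forall>v\<in>pool (par u). c \<le> degree X (up u) v (pool u)) \<longrightarrow>
    (\<exists>\<iota> A. separated R (copies depth d S) \<iota> A \<and> embeds par x up pool d (copies depth d S) \<iota> \<and>
      (\<forall>p\<in>copies depth d S. finite (A p) \<and> card (A p) \<le> b * d))"
proof -
  have depth: "par u \<in> V \<and> depth u = Suc (depth (par u))" if "u \<in> V" "u \<noteq> x" for u
    using step that by simp
  have "finite S" using S(1) V(1) by (rule finite_subset)
  then show ?thesis
    using S
  proof (induction S arbitrary: R rule: finite_psubset_induct)
    case (psubset S)
    show ?case
    proof (cases "S = {x}")
      case True
      have single: "copies depth d S = {(x, 0)}" for d
        unfolding True copies_def using root by auto
      show ?thesis
      proof (intro exI[of _ "1 :: real"] exI[of _ 0] conjI allI impI)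
        fix X :: "'b set" and pool d
        assume *: "finite X \<and> 0 \<le> card X \<and> real d \<le> 1 * real (card X) \<and>
          (\<forall>u\<in>V. pool u \<subseteq> inner X) \<and> pool x \<noteq> {} \<and>
          (\<forall>u\<in>V - {x}. \<forall>v\<in>pool (par u). c \<le> degree X (up u) v (pool u))"
        then obtain w where "w \<in> pool x" by blast
        then show "\<exists>\<iota> A. separated R (copies depth d S) \<iota> A \<and> embeds par x up pool d (copies depth d S) \<iota> \<and>
            (\<forall>p\<in>copies depth d S. finite (A p) \<and> card (A p) \<le> 0 * d)"
          by (intro exI[of _ "\<lambda>_. w"] exI[of _ "\<lambda>_. {}"]) (simp add: single embeds_def separated_def)
      qed simp
    next
      case False
      then have ne: "S - {x} \<noteq> {}" using psubset.prems(2) by blast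
      have fS: "finite (S - {x})" using psubset.hyps by simp
      have "Max (depth ` (S - {x})) \<in> depth ` (S - {x})" using fS ne by (intro Max_in) auto
      then obtain u where "u \<in> S - {x}" and du_Max: "depth u = Max (depth ` (S - {x}))" by force
      then have u: "u \<in> S" "u \<noteq> x" by auto
      then have umax: "depth w \<le> depth u" if "w \<in> S" "w \<noteq> x" for w
        unfolding du_Max using that fS by (intro Max_ge) auto
      have uV: "u \<in> V" using u(1) psubset.prems(1) by blast
      let ?S = "S - {u}"
      define D where "D = Max (depth ` V)"
      have D: "depth w \<le> D" if "w \<in> V" for w using that V(1) by (simp add: D_def)
      define K where "K = D + 2 * R"
      have closed: "\<forall>w\<in>?S - {x}. par w \<in> ?S"
      proof
        fix w assume w: "w \<in> ?S - {x}"
        then have "w \<in> V" "w \<noteq> x" using psubset.prems(1) by auto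
        then have "depth w = Suc (depth (par w))" using depth by blast
        then have "par w \<noteq> u" using umax[of w] w by auto
        then show "par w \<in> ?S" using psubset.prems(3) w by auto
      qed
      have "?S \<subset> S" "?S \<subseteq> V" "x \<in> ?S" using u psubset.prems by auto
      from psubset.IH[OF this closed, of "R + K"]
      obtain \<delta> N b where \<delta>: "0 < \<delta>" and IH: "\<forall>(X :: 'b set) pool d.
        finite X \<and> N \<le> card X \<and> real d \<le> \<delta> * real (card X) \<and>
        (\<forall>u\<in>V. pool u \<subseteq> inner X) \<and> pool x \<noteq> {} \<and>
        (\<forall>u\<in>V - {x}. \<forall>v\<in>pool (par u). c \<le> degree X (up u) v (pool u)) \<longrightarrow>
        (\<exists>\<iota> A. separated (R + K) (copies depth d ?S) \<iota> A \<and> embeds par x up pool d (copies depth d ?S) \<iota> \<and>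
          (\<forall>p\<in>copies depth d ?S. finite (A p) \<and> card (A p) \<le> b * d))"
        by (elim exE conjE) (rule that)
      obtain N' where N': "\<forall>n\<ge>N'. real (card V * n ^ D * (n + 1) ^ (2 * R)) *
          (real (K + 1) / real (n div 4)) ^ (K + 1) < c / 2"
        using ball_weight_small[OF c, of "card V" D R] unfolding K_def by blast
      \<comment> \<open>The factor 32 allows for \<open>n div 4 \<ge> n / 8\<close> and for the bound \<open>c / 4\<close> on the reserved elements and on the number of siblings.\<close>
      define \<delta>' where "\<delta>' = min \<delta> (min 1 (c / (32 * (real (K * K * b) + 1))))"
      have \<delta>': "0 < \<delta>'" "\<delta>' \<le> \<delta>" "\<delta>' \<le> 1" "\<delta>' \<le> c / (32 * (real (K * K * b) + 1))"
        using \<delta> c by (auto simp: \<delta>'_def intro!: divide_pos_pos add_nonneg_pos)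
      \<comment> \<open>The last summand ensures that \<open>K < n div 4\<close>.\<close>
      define N2 where "N2 = N + N' + 8 * (K + 1)"
      show ?thesis
      proof (intro exI[of _ \<delta>'] conjI \<delta>'(1), rule exI[of _ N2], rule exI[of _ "b + K"],
          intro allI impI)
        fix X :: "'b set" and pool d
        assume *: "finite X \<and> N2 \<le> card X \<and> real d \<le> \<delta>' * real (card X) \<and>
          (\<forall>u\<in>V. pool u \<subseteq> inner X) \<and> pool x \<noteq> {} \<and>
          (\<forall>u\<in>V - {x}. \<forall>v\<in>pool (par u). c \<le> degree X (up u) v (pool u))"
        let ?n = "card X" and ?I = "copies depth d ?S"
        from * have fX: "finite X" and nX: "N2 \<le> ?n" and dn: "real d \<le> \<delta>' * real ?n"
          and pool: "\<forall>w\<in>V. pool w \<subseteq> inner X" "pool x \<noteq> {}"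
          and deg: "\<forall>w\<in>V - {x}. \<forall>v\<in>pool (par w). c \<le> degree X (up w) v (pool w)"
          by simp_all
        have n: "N \<le> ?n" "N' \<le> ?n" "8 * (K + 1) \<le> ?n" using nX by (simp_all add: N2_def)
        then have n8: "8 \<le> ?n" by simp
        note dn
        also have "\<delta>' * real ?n \<le> \<delta> * real ?n" using \<delta>'(2) by (rule mult_right_mono) simp
        finally have d\<delta>: "real d \<le> \<delta> * real ?n" .
        obtain \<iota> A where IHr: "separated (R + K) ?I \<iota> A" "embeds par x up pool d ?I \<iota>"
          "\<forall>p\<in>?I. finite (A p) \<and> card (A p) \<le> b * d"
          using IH[THEN spec, THEN spec, THEN spec, THEN mp, OF conjI[OF fX conjI[OF n(1) conjI[OF d\<delta> conjI[OF pool(1) conjI[OF pool(2) deg]]]]]]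
          by (elim exE conjE) (rule that)
        have "\<delta>' * real ?n \<le> 1 * real ?n" using \<delta>' by (intro mult_right_mono) auto
        then have dn1: "d \<le> ?n" using dn by simp
        have "\<delta>' * real ?n \<le> c / (32 * (real (K * K * b) + 1)) * real ?n"
          using \<delta>' by (intro mult_right_mono) auto
        then have "real d \<le> c / (32 * (real (K * K * b) + 1)) * real ?n" using dn by linarith
        moreover have "0 < 32 * (real (K * K * b) + 1)" by (intro mult_pos_pos add_nonneg_pos) auto
        ultimately have "(real (K * K * b) + 1) * real d \<le> c / 4 * (real ?n / 8)"
          by (simp add: field_simps)
        also have "\<dots> \<le> c / 4 * real (?n div 4)"
          using quarter_ge[OF n8] c by (intro mult_left_mono) auto
        finally have d: "(real (K * K * b) + 1) * real d \<le> c / 4 * real (?n div 4)" .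
        define J where "J = copies depth d {u}"
        define parJ where "parJ = (\<lambda>(w, i). (par w, i div d))"
        have du: "depth u = Suc (depth (par u))" and parV: "par u \<in> V" using depth uV u(2) by blast+
        have "par u \<noteq> u" using du by auto
        then have parS: "par u \<in> ?S" using psubset.prems(3) u by blast
        have union: "?I \<union> J = copies depth d S" using u(1) by (auto simp: copies_def J_def)
        have disj: "?I \<inter> J = {}" by (auto simp: copies_def J_def)
        have finI: "finite ?I" "finite J"
          using psubset.hyps by (simp_all add: copies_Sigma J_def)
        have "card ?I + card J = card (copies depth d S)"
          using card_Un_disjoint[OF finI disj] by (simp only: union)
        also have "\<dots> \<le> card S * ?n ^ D"
          using psubset.prems(1) D dn1 n8 by (intro card_copies_le(2)[OF psubset.hyps]) auto
        also have "\<dots> \<le> card V * ?n ^ D"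
          using card_mono[OF V(1) psubset.prems(1)] by (intro mult_right_mono) auto
        finally have cardIJ: "card ?I + card J \<le> card V * ?n ^ D" .
        have parI: "parJ j \<in> ?I" if j: "j \<in> J" for j
        proof -
          obtain i where i: "j = (u, i)" "i < d ^ Suc (depth (par u))"
            using j du by (auto simp: J_def copies_def)
          then have "i div d < d ^ depth (par u)"
            by (intro less_mult_imp_div_less) (simp add: mult.commute)
          then show ?thesis using i parS by (simp add: parJ_def copies_def)
        qed
        have fibre: "card {j \<in> J. parJ j = p} \<le> d" for p
        \<comment> \<open>Recovering \<open>i\<close> from its quotient and remainder needs \<open>d > 0\<close>.\<close>
        proof (cases "d = 0")
          case True
          then have "J = {}" using du by (simp add: J_def copies_def)
          then show ?thesis by simp
        next
          case False
          have "{j \<in> J. parJ j = p} \<subseteq> (\<lambda>r. (u, snd p * d + r)) ` {..<d}"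
          proof
            fix j assume "j \<in> {j \<in> J. parJ j = p}"
            then obtain i where i: "j = (u, i)" "i div d = snd p"
              by (auto simp: J_def copies_def parJ_def)
            then have "j = (u, snd p * d + i mod d)" using div_mult_mod_eq[of i d] by simp
            then show "j \<in> (\<lambda>r. (u, snd p * d + r)) ` {..<d}" using False by simp
          qed
          then have "card {j \<in> J. parJ j = p} \<le> card {..<d}" by (intro surj_card_le) auto
          then show ?thesis by simp
        qed
        have \<iota>pool: "\<iota> p \<in> pool (fst p)" if "p \<in> ?I" for p
          using IHr(2) that by (cases p) (simp add: embedsD(1)[OF IHr(2)])
        have \<iota>inner: "\<iota> p \<in> inner X" if "p \<in> ?I" for p
        proof -
          have "fst p \<in> V" using that psubset.prems(1) by (auto simp: copies_def)
          then have "pool (fst p) \<subseteq> inner X" using pool(1) by blast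
          then show ?thesis using \<iota>pool[OF that] by (rule subsetD)
        qed
        have degJ: "c \<le> degree X (up u) (\<iota> (parJ j)) (pool u)" if j: "j \<in> J" for j
        proof -
          have "fst (parJ j) = par u" using j by (auto simp: J_def copies_def parJ_def)
          then have "\<iota> (parJ j) \<in> pool (par u)" using \<iota>pool[OF parI[OF j]] by simp
          moreover have "u \<in> V - {x}" using uV u(2) by simp
          ultimately show ?thesis using deg by blast
        qed
        have "\<exists>\<iota>' A'. separated R (?I \<union> J) \<iota>' A' \<and> (\<forall>p\<in>?I. \<iota>' p = \<iota> p) \<and>
          (\<forall>j\<in>J. \<iota>' j \<in> pool u \<and> toward (up u) (\<iota> (parJ j)) (\<iota>' j)) \<and>
          (\<forall>q\<in>?I \<union> J. finite (A' q) \<and> card (A' q) \<le> b * d + d * K)"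
        proof (rule add_children[OF _ IHr(1) finI disj cardIJ parI fibre \<iota>inner _ _ degJ c])
          show "finite X" "pool u \<subseteq> inner X" using fX pool(1) uV by simp_all
          show "finite (A p) \<and> card (A p) \<le> b * d" if "p \<in> ?I" for p using IHr(3) that by blast
          show "K < ?n div 4" using n(3) by simp
          have "real (K * K * (b * d)) \<le> (real (K * K * b) + 1) * real d" by (simp add: algebra_simps)
          then show "real (K * K * (b * d)) \<le> c / 4 * real (?n div 4)" using d by linarith
          have "real d \<le> (real (K * K * b) + 1) * real d" by (simp add: algebra_simps)
          then show "real d \<le> c / 4 * real (?n div 4)" using d by linarith
          show "real (card V * ?n ^ D * (?n + 1) ^ (2 * R)) *
              (real (K + 1) / real (?n div 4)) ^ (K + 1) < c / 2"
            using N' n(2) by blast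
        qed
        then obtain \<iota>' A' where new: "separated R (copies depth d S) \<iota>' A'" "\<forall>p\<in>?I. \<iota>' p = \<iota> p"
          "\<forall>j\<in>J. \<iota>' j \<in> pool u \<and> toward (up u) (\<iota> (parJ j)) (\<iota>' j)"
          "\<forall>q\<in>copies depth d S. finite (A' q) \<and> card (A' q) \<le> b * d + d * K"
          unfolding union by (elim exE conjE) (rule that)
        have "embeds par x up pool d (copies depth d S) \<iota>'"
          unfolding embeds_def
        proof (intro ballI, clarify)
          fix w i assume wi: "(w, i) \<in> copies depth d S"
          show "\<iota>' (w, i) \<in> pool w \<and> (w \<noteq> x \<longrightarrow> toward (up w) (\<iota>' (par w, i div d)) (\<iota>' (w, i)))"
          proof (cases "w = u")
            case True
            then have j: "(w, i) \<in> J" using wi by (simp add: J_def copies_def)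
            have "\<iota>' (parJ (w, i)) = \<iota> (parJ (w, i))" using new(2) parI[OF j] by blast
            then show ?thesis using new(3) j True by (auto simp: parJ_def)
          next
            case False
            then have I: "(w, i) \<in> ?I" using wi by (simp add: copies_def)
            have "(par w, i div d) \<in> ?I" if "w \<noteq> x"
            proof -
              have "depth w = Suc (depth (par w))" using depth that I psubset.prems(1)
                by (auto simp: copies_def)
              then have "i < d ^ depth (par w) * d" using I by (simp add: copies_def mult.commute)
              then have "i div d < d ^ depth (par w)" by (rule less_mult_imp_div_less)
              then show ?thesis using closed that I by (simp add: copies_def)
            qed
            then show ?thesis
              using embedsD[OF IHr(2) I] bspec[OF new(2) I] bspec[OF new(2)] by simp
          qed
        qed
        moreover have "b * d + d * K = (b + K) * d" by (simp add: algebra_simps)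
        ultimately show "\<exists>\<iota> A. separated R (copies depth d S) \<iota> A \<and>
            embeds par x up pool d (copies depth d S) \<iota> \<and>
            (\<forall>p\<in>copies depth d S. finite (A p) \<and> card (A p) \<le> (b + K) * d)"
          using new(1,4) by (intro exI[of _ \<iota>'] exI[of _ A']) simp
      qed
    qed
  qed
qed

section \<open>Trees as Hasse diagrams\<close>

lemma simple_path:
  assumes "(a, b) \<in> G\<^sup>*"
  shows "\<exists>c. c \<noteq> [] \<and> hd c = a \<and> last c = b \<and> distinct c \<and>
    successively (\<lambda>u v. (u, v) \<in> G) c \<and> set c \<subseteq> insert a (Range G)"
  using assms
proof (induction rule: rtrancl_induct)
  case base
  show ?case by (rule exI[of _ "[a]"]) simp
next
  case (step y z)
  then obtain c where c: "c \<noteq> []" "hd c = a" "last c = y" "distinct c"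
    "successively (\<lambda>u v. (u, v) \<in> G) c" "set c \<subseteq> insert a (Range G)" by blast
  show ?case
  proof (cases "z \<in> set c")
    case True
    then obtain p s where ps: "c = p @ z # s" by (meson split_list)
    have "successively (\<lambda>u v. (u, v) \<in> G) ((p @ [z]) @ s)" using c(5) ps by simp
    then have "successively (\<lambda>u v. (u, v) \<in> G) (p @ [z])"
      unfolding successively_append_iff[of _ "p @ [z]" s] by (rule conjunct1)
    moreover have "hd (p @ [z]) = a" using c(2) ps by (cases p) auto
    moreover have "distinct (p @ [z])" "set (p @ [z]) \<subseteq> insert a (Range G)" using c(4,6) ps by auto
    ultimately show ?thesis by (intro exI[of _ "p @ [z]"]) simp
  next
    case False
    have "successively (\<lambda>u v. (u, v) \<in> G) (c @ [z])"
      using c(1,3,5) step.hyps(2) by (simp add: successively_append_iff)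
    moreover have "set (c @ [z]) \<subseteq> insert a (Range G)" using c(6) step.hyps(2) by auto
    ultimately show ?thesis using c False by (intro exI[of _ "c @ [z]"]) simp
  qed
qed

definition avoiding :: "'a \<Rightarrow> 'a rel \<Rightarrow> 'a rel" where
  "avoiding u E = {(v, w) \<in> E. v \<noteq> u \<and> w \<noteq> u}"

text \<open>
  A simple path between two neighbours of \<open>u\<close> that avoids \<open>u\<close> closes up to a cycle.
\<close>
lemma cycle_through_vertex:
  assumes sym: "sym E" and e: "(u, v) \<in> E" "(u, w) \<in> E" "v \<noteq> w" "v \<noteq> u"
    and conn: "(v, w) \<in> (avoiding u E)\<^sup>*"
  shows "\<exists>c. is_cycle E c"
proof -
  obtain c where c: "c \<noteq> []" "hd c = v" "last c = w" "distinct c"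
    "successively (\<lambda>a b. (a, b) \<in> avoiding u E) c" "set c \<subseteq> insert v (Range (avoiding u E))"
    using simple_path[OF conn] by blast
  have "u \<notin> set c" using c(6) e(4) by (auto simp: avoiding_def)
  moreover have "successively (\<lambda>a b. (a, b) \<in> E) c"
    using c(5) by (rule successively_mono) (auto simp: avoiding_def)
  moreover have "2 \<le> length c"
    using c(1-3) e(3) by (cases c; cases "tl c") auto
  moreover have "(w, u) \<in> E" using sym e(2) by (rule symD)
  ultimately have "is_cycle E (u # c)"
    using c e(1) by (cases c) (auto simp: is_cycle_def)
  then show ?thesis ..
qed

lemma sym_hasse_graph: "sym (hasse_graph T)"
  by (auto simp: hasse_graph_def sym_def)

lemma hasse_graph_irrefl: "(u, v) \<in> hasse_graph T \<Longrightarrow> u \<noteq> v"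
  by (auto simp: hasse_graph_def hasse_def)

lemma hasse_graph_Field: "(u, v) \<in> hasse_graph T \<Longrightarrow> u \<in> Field T \<and> v \<in> Field T"
  by (auto simp: hasse_graph_def hasse_def Field_def)

text \<open>
  The form in which acyclicity is used: from a given \<open>y\<close>, only one neighbour of \<open>u\<close> can be
  reached without passing through \<open>u\<close>.
\<close>
lemma no_two_paths:
  assumes "tree_poset T" "(u, v) \<in> hasse_graph T" "(u, w) \<in> hasse_graph T"
    and conn: "(y, v) \<in> (avoiding u (hasse_graph T))\<^sup>*" "(y, w) \<in> (avoiding u (hasse_graph T))\<^sup>*"
  shows "v = w"
proof (rule ccontr)
  assume "v \<noteq> w"
  have "sym (avoiding u (hasse_graph T))"
    using sym_hasse_graph[of T] by (auto simp: avoiding_def sym_def)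
  then have "(v, y) \<in> (avoiding u (hasse_graph T))\<^sup>*"
    using conn(1) by (meson sym_rtrancl symD)
  then have "(v, w) \<in> (avoiding u (hasse_graph T))\<^sup>*" using conn(2) by (rule rtrancl_trans)
  then have "\<exists>c. is_cycle (hasse_graph T) c"
    using assms(2,3) \<open>v \<noteq> w\<close> hasse_graph_irrefl[OF assms(2)]
    by (intro cycle_through_vertex[OF sym_hasse_graph]) auto
  then show False using assms(1) by (simp add: tree_poset_def is_tree_def)
qed

definition parent :: "'a rel \<Rightarrow> 'a \<Rightarrow> 'a \<Rightarrow> 'a" where
  "parent T x u = (SOME v. (v, u) \<in> hasse_graph T \<and> hasse_dist T x u = Suc (hasse_dist T x v))"

lemma hasse_dist_self: "hasse_dist T x x = 0"
  by (simp add: hasse_dist_def Least_eq_0)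

lemma hasse_dist_le: "(x, u) \<in> hasse_graph T ^^ k \<Longrightarrow> hasse_dist T x u \<le> k"
  unfolding hasse_dist_def by (rule Least_le)

lemma hasse_dist_path:
  assumes "tree_poset T" "x \<in> Field T" "u \<in> Field T"
  shows "(x, u) \<in> hasse_graph T ^^ hasse_dist T x u"
proof -
  have "(x, u) \<in> (hasse_graph T)\<^sup>*" using assms by (simp add: tree_poset_def is_tree_def)
  then obtain k where "(x, u) \<in> hasse_graph T ^^ k" by (auto simp: rtrancl_power)
  then show ?thesis unfolding hasse_dist_def by (rule LeastI)
qed

lemma parent_edge:
  assumes T: "tree_poset T" "x \<in> Field T" "u \<in> Field T" and ne: "u \<noteq> x"
  shows "(parent T x u, u) \<in> hasse_graph T" "hasse_dist T x u = Suc (hasse_dist T x (parent T x u))"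
proof -
  have path: "(x, u) \<in> hasse_graph T ^^ hasse_dist T x u" by (rule hasse_dist_path[OF T])
  then obtain k where k: "hasse_dist T x u = Suc k" using ne by (cases "hasse_dist T x u") auto
  then obtain z where z: "(x, z) \<in> hasse_graph T ^^ k" "(z, u) \<in> hasse_graph T"
    using path by auto
  have "z \<in> Field T" using hasse_graph_Field[OF z(2)] by simp
  then have "(x, z) \<in> hasse_graph T ^^ hasse_dist T x z" by (rule hasse_dist_path[OF T(1,2)])
  then have "(x, u) \<in> hasse_graph T ^^ Suc (hasse_dist T x z)" using z(2) by auto
  then have "k \<le> hasse_dist T x z" using hasse_dist_le k by fastforce
  moreover have "hasse_dist T x z \<le> k" using z(1) by (rule hasse_dist_le)
  ultimately have "(z, u) \<in> hasse_graph T \<and> hasse_dist T x u = Suc (hasse_dist T x z)"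
    using z(2) k by simp
  then have "(parent T x u, u) \<in> hasse_graph T \<and> hasse_dist T x u = Suc (hasse_dist T x (parent T x u))"
    unfolding parent_def by (rule someI)
  then show "(parent T x u, u) \<in> hasse_graph T" "hasse_dist T x u = Suc (hasse_dist T x (parent T x u))"
    by auto
qed

lemma root_path_avoiding:
  assumes T: "tree_poset T" "x \<in> Field T" and z: "z \<in> Field T"
    and "hasse_dist T x z \<le> hasse_dist T x u" "z \<noteq> u"
  shows "(x, z) \<in> (avoiding u (hasse_graph T))\<^sup>*"
  using z assms(4,5)
proof (induction "hasse_dist T x z" arbitrary: z rule: less_induct)
  case less
  show ?case
  proof (cases "z = x")
    case False
    let ?p = "parent T x z"
    note p = parent_edge[OF T less.prems(1) False]
    have "?p \<in> Field T" using hasse_graph_Field[OF p(1)] by simp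
    moreover have "?p \<noteq> u" using p(2) less.prems(2) by auto
    ultimately have "(x, ?p) \<in> (avoiding u (hasse_graph T))\<^sup>*"
      using p(2) less.prems(2) by (intro less.hyps) auto
    moreover have "(?p, z) \<in> avoiding u (hasse_graph T)"
      using p(1) \<open>?p \<noteq> u\<close> less.prems(3) by (simp add: avoiding_def)
    ultimately show ?thesis by (rule rtrancl_into_rtrancl)
  qed simp
qed

text \<open>
  Shortest paths from the root to vertices not farther than \<open>u\<close> avoid \<open>u\<close>, so two neighbours of
  \<open>u\<close> closer to the root would both be reached without passing through \<open>u\<close>.
\<close>
lemma parent_unique:
  assumes T: "tree_poset T" "x \<in> Field T"
    and v: "(v, u) \<in> hasse_graph T" "hasse_dist T x u = Suc (hasse_dist T x v)"
  shows "v = parent T x u"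
proof -
  have F: "u \<in> Field T" "v \<in> Field T" using hasse_graph_Field[OF v(1)] by auto
  have "u \<noteq> x" using v(2) hasse_dist_self[of T x] by auto
  note p = parent_edge[OF T F(1) this]
  have Fp: "parent T x u \<in> Field T" using hasse_graph_Field[OF p(1)] by simp
  show ?thesis
  proof (rule no_two_paths[OF T(1)])
    show "(u, v) \<in> hasse_graph T" "(u, parent T x u) \<in> hasse_graph T"
      using v(1) p(1) sym_hasse_graph[of T] by (auto dest: symD)
    show "(x, v) \<in> (avoiding u (hasse_graph T))\<^sup>*"
      using v by (intro root_path_avoiding[OF T F(2)]) auto
    show "(x, parent T x u) \<in> (avoiding u (hasse_graph T))\<^sup>*"
      using p(2) hasse_graph_irrefl[OF p(1)] by (intro root_path_avoiding[OF T Fp]) simp_all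
  qed
qed

lemma finite_posetD:
  assumes "finite_poset T"
  shows "finite (Field T)" "trans T" "antisym T" "u \<in> Field T \<Longrightarrow> (u, u) \<in> T"
  using assms by (auto simp: finite_poset_def order_on_defs dest: refl_onD)

lemma tree_posetD: "tree_poset T \<Longrightarrow> finite_poset T"
  by (simp add: tree_poset_def)

lemma hasse_path:
  assumes T: "finite_poset T" and "(a, b) \<in> T"
  shows "(a, b) \<in> (hasse T)\<^sup>*"
  using assms(2)
proof (induction "card {z. (a, z) \<in> T \<and> (z, b) \<in> T}" arbitrary: a b rule: less_induct)
  case less
  note P = finite_posetD[OF T]
  show ?case
  proof (cases "a = b \<or> (a, b) \<in> hasse T")
    case False
    then obtain z where z: "z \<noteq> a" "z \<noteq> b" "(a, z) \<in> T" "(z, b) \<in> T"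
      using less.prems unfolding hasse_def by blast
    let ?I = "\<lambda>a b. {z. (a, z) \<in> T \<and> (z, b) \<in> T}"
    have fin: "finite (?I a b)" by (rule finite_subset[OF _ P(1)]) (auto simp: Field_def)
    have ab: "a \<in> ?I a b" "b \<in> ?I a b"
      using P(4)[OF FieldI1[OF less.prems]] P(4)[OF FieldI2[OF less.prems]] less.prems by simp_all
    have sub: "?I a z \<subseteq> ?I a b" "?I z b \<subseteq> ?I a b"
      using transD[OF P(2) _ z(4)] transD[OF P(2) z(3)] by auto
    have "b \<notin> ?I a z" "a \<notin> ?I z b"
      using z(1,2) antisymD[OF P(3) z(4)] antisymD[OF P(3) z(3)] by auto
    then have "?I a z \<subset> ?I a b" "?I z b \<subset> ?I a b" using sub ab by blast+
    then have "card (?I a z) < card (?I a b)" "card (?I z b) < card (?I a b)"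
      using psubset_card_mono[OF fin] by simp_all
    then have "(a, z) \<in> (hasse T)\<^sup>*" "(z, b) \<in> (hasse T)\<^sup>*"
      using less.hyps z(3,4) by simp_all
    then show ?thesis by (rule rtrancl_trans)
  qed auto
qed

lemma hasse_path_avoiding:
  assumes T: "finite_poset T" and u: "u \<in> Field T" and path: "(a, z) \<in> (hasse T)\<^sup>*" and "(u, z) \<notin> T"
  shows "(a, z) \<in> (avoiding u (hasse_graph T))\<^sup>*"
  using path assms(4)
proof (induction rule: rtrancl_induct)
  case (step y z)
  note P = finite_posetD[OF T]
  have yz: "(y, z) \<in> T" using step.hyps(2) by (simp add: hasse_def)
  then have uy: "(u, y) \<notin> T" using step.prems transD[OF P(2) _ yz] by blast
  have "y \<noteq> u" "z \<noteq> u" using P(4)[OF u] uy step.prems by auto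
  then have "(y, z) \<in> avoiding u (hasse_graph T)"
    using step.hyps(2) by (simp add: avoiding_def hasse_graph_def)
  with step.IH[OF uy] show ?case by (rule rtrancl_into_rtrancl)
qed simp

text \<open>
  A vertex \<open>u > x\<close> is reached from \<open>x\<close> along a chain of covers, whose last vertex before \<open>u\<close> lies
  below \<open>u\<close>; if the parent were above \<open>u\<close>, then two neighbours of \<open>u\<close> could be reached from \<open>x\<close>
  without passing through \<open>u\<close>. The parent is then comparable to \<open>x\<close> and covered by \<open>u\<close>, so it
  cannot lie strictly below \<open>x\<close>.
\<close>
lemma parent_of_above:
  assumes T: "tree_poset T" "x \<in> Field T" and comp: "comparable_to_all T x"
    and u: "(x, u) \<in> T" "u \<noteq> x"
  shows "(parent T x u, u) \<in> hasse T" "(x, parent T x u) \<in> T"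
proof -
  note P = finite_posetD[OF tree_posetD[OF T(1)]]
  let ?p = "parent T x u"
  have uF: "u \<in> Field T" using u(1) by (auto simp: Field_def)
  note p = parent_edge[OF T uF u(2)]
  have pF: "?p \<in> Field T" using hasse_graph_Field[OF p(1)] by simp
  have "(u, ?p) \<notin> hasse T"
  proof
    assume up: "(u, ?p) \<in> hasse T"
    obtain z where z: "(x, z) \<in> (hasse T)\<^sup>*" "(z, u) \<in> hasse T"
      using hasse_path[OF tree_posetD[OF T(1)] u(1)] u(2) by (metis rtranclE)
    have zu: "(z, u) \<in> T" "z \<noteq> u" using z(2) by (auto simp: hasse_def)
    then have "(u, z) \<notin> T" using antisymD[OF P(3) zu(1)] by blast
    have "?p = z"
    proof (rule no_two_paths[OF T(1)])
      show "(u, ?p) \<in> hasse_graph T" "(u, z) \<in> hasse_graph T"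
        using up z(2) by (auto simp: hasse_graph_def)
      show "(x, ?p) \<in> (avoiding u (hasse_graph T))\<^sup>*"
        using p(2) hasse_graph_irrefl[OF p(1)] by (intro root_path_avoiding[OF T pF]) simp_all
      show "(x, z) \<in> (avoiding u (hasse_graph T))\<^sup>*"
        by (rule hasse_path_avoiding[OF tree_posetD[OF T(1)] uF z(1)]) fact
    qed
    then show False using up \<open>(u, z) \<notin> T\<close> by (simp add: hasse_def)
  qed
  then show pu: "(?p, u) \<in> hasse T" using p(1) by (auto simp: hasse_graph_def)
  consider "(x, ?p) \<in> T" | "(?p, x) \<in> T" using comp pF by (auto simp: comparable_to_all_def)
  then show "(x, ?p) \<in> T"
  proof cases
    case 2
    then have "x = ?p" using pu u unfolding hasse_def by blast
    then show ?thesis using P(4)[OF T(2)] by simp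
  qed
qed

text \<open>
  Reversing the order keeps distances and parents, which yields the facts about the vertices
  below \<open>x\<close>.
\<close>
lemma hasse_converse: "hasse (T\<inverse>) = (hasse T)\<inverse>"
  by (auto simp: hasse_def)

lemma hasse_graph_converse: "hasse_graph (T\<inverse>) = hasse_graph T"
  by (auto simp: hasse_graph_def hasse_converse)

lemma hasse_dist_converse: "hasse_dist (T\<inverse>) x = hasse_dist T x"
  by (rule ext) (simp add: hasse_dist_def hasse_graph_converse)

lemma parent_converse: "parent (T\<inverse>) x = parent T x"
  by (rule ext) (simp add: parent_def hasse_graph_converse hasse_dist_converse)

lemma tree_poset_converse: "tree_poset T \<Longrightarrow> tree_poset (T\<inverse>)"
  by (simp add: tree_poset_def finite_poset_def hasse_graph_converse)

lemma parent_of_below: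
  assumes "tree_poset T" "x \<in> Field T" "comparable_to_all T x" "(u, x) \<in> T" "u \<noteq> x"
  shows "(u, parent T x u) \<in> hasse T" "(parent T x u, x) \<in> T"
  using parent_of_above[OF tree_poset_converse[OF assms(1)], of x u] assms
  by (auto simp: comparable_to_all_def hasse_converse parent_converse)

lemma chain_of_hasse_path:
  assumes T: "finite_poset T" and "(a, b) \<in> hasse T ^^ m" "a \<in> Field T"
  shows "\<exists>C\<in>Chains T. card C = Suc m \<and> finite C \<and> b \<in> C \<and> (\<forall>z\<in>C. (z, b) \<in> T)"
  using assms(2)
proof (induction m arbitrary: b)
  case 0
  then show ?case using finite_posetD(4)[OF T assms(3)] by (intro bexI[of _ "{a}"]) (auto simp: Chains_def)
next
  case (Suc m)
  note P = finite_posetD[OF T]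
  obtain y where y: "(a, y) \<in> hasse T ^^ m" "(y, b) \<in> hasse T" using Suc.prems by auto
  obtain C where C: "C \<in> Chains T" "card C = Suc m" "finite C" "y \<in> C" "\<forall>z\<in>C. (z, y) \<in> T"
    using Suc.IH[OF y(1)] by blast
  have yb: "(y, b) \<in> T" "y \<noteq> b" using y(2) by (auto simp: hasse_def)
  have below: "(z, b) \<in> T" if "z \<in> C" for z
    using transD[OF P(2) _ yb(1)] C(5) that by blast
  have "b \<notin> C" using C(5) yb(2) antisymD[OF P(3) yb(1)] by blast
  moreover have "(b, b) \<in> T" using yb(1) by (intro P(4)) (auto simp: Field_def)
  ultimately show ?case using C below
    by (intro bexI[of _ "insert b C"]) (auto simp: Chains_def)
qed

lemma poset_height_ge:
  assumes T: "finite_poset T" and "(a, b) \<in> hasse T ^^ m" "a \<in> Field T"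
  shows "Suc m \<le> poset_height T"
proof -
  obtain C where C: "C \<in> Chains T" "card C = Suc m"
    using chain_of_hasse_path[OF assms] by blast
  have "Chains T \<subseteq> Pow (Field T)" by (auto simp: Chains_def Field_def)
  then have "finite (Chains T)" using finite_posetD(1)[OF T] by (meson finite_Pow_iff finite_subset)
  then have "card C \<le> Max (card ` Chains T)" using C(1) by (intro Max_ge) auto
  then show ?thesis using C(2) by (simp add: poset_height_def)
qed

lemma sym_relpow:
  assumes "sym R" "(a, b) \<in> R ^^ k"
  shows "(b, a) \<in> R ^^ k"
  using assms(2)
proof (induction k arbitrary: b)
  case (Suc k)
  then obtain y where y: "(a, y) \<in> R ^^ k" "(y, b) \<in> R" by auto
  show ?case using symD[OF assms(1) y(2)] Suc.IH[OF y(1)] by (rule relpow_Suc_I2)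
qed simp

text \<open>
  Saturated chains from \<open>w\<close> to \<open>x\<close> and from \<open>x\<close> to \<open>u\<close> are paths in the Hasse diagram, hence at
  least as long as the distances, and together they form one chain.
\<close>
lemma arms_le_height:
  assumes T: "finite_poset T" and w: "(w, x) \<in> T" and u: "(x, u) \<in> T"
  shows "hasse_dist T x w + hasse_dist T x u + 1 \<le> poset_height T"
proof -
  obtain k l where k: "(w, x) \<in> hasse T ^^ k" and l: "(x, u) \<in> hasse T ^^ l"
    using hasse_path[OF T w] hasse_path[OF T u] unfolding rtrancl_power by (elim exE) (rule that)
  have sub: "hasse T \<subseteq> hasse_graph T" by (simp add: hasse_graph_def)
  have mono: "hasse T ^^ j \<subseteq> hasse_graph T ^^ j" for j
  proof (induction j)
    case (Suc j)
    then show ?case unfolding relpow.simps using sub by (rule relcomp_mono)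
  qed simp
  have "(x, w) \<in> hasse_graph T ^^ k"
    using subsetD[OF mono k] by (rule sym_relpow[OF sym_hasse_graph])
  then have "hasse_dist T x w \<le> k" by (rule hasse_dist_le)
  moreover have "hasse_dist T x u \<le> l" using subsetD[OF mono l] by (rule hasse_dist_le)
  moreover have "(w, u) \<in> hasse T ^^ (k + l)" unfolding relpow_add using k l by (rule relcompI)
  then have "Suc (k + l) \<le> poset_height T"
    using FieldI1[OF w] by (rule poset_height_ge[OF T])
  ultimately show ?thesis by simp
qed

section \<open>Layers far from the middle\<close>

text \<open>
  Up to a third of \<open>n\<close>, each binomial coefficient is at least twice the previous one.
\<close>
lemma binomial_doubling:
  fixes n k t :: nat
  assumes "3 * (k + t) \<le> n"
  shows "2 ^ t * (n choose k) \<le> n choose (k + t)"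
  using assms
proof (induction t)
  case (Suc t)
  define m where "m = k + t"
  have m: "2 * Suc m \<le> n - m" using Suc.prems by (simp add: m_def)
  have "Suc m * (2 * (n choose m)) = 2 * Suc m * (n choose m)" by (simp only: mult_ac)
  also have "\<dots> \<le> (n - m) * (n choose m)" using m by (rule mult_right_mono) simp
  also have "\<dots> = Suc m * (n choose Suc m)"
    using binomial_absorb_comp[of n m] times_binomial_minus1_eq[of "Suc m" n] by simp
  finally have "2 * (n choose m) \<le> n choose Suc m" by (simp only: mult_le_cancel1 zero_less_Suc simp_thms)
  moreover have "3 * (k + t) \<le> n" using Suc.prems by simp
  then have "2 ^ t * (n choose k) \<le> n choose m" unfolding m_def by (rule Suc.IH)
  then have "2 * (2 ^ t * (n choose k)) \<le> 2 * (n choose m)" by (rule mult_left_mono) simp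
  ultimately have "2 * (2 ^ t * (n choose k)) \<le> n choose Suc m" by (rule order.trans[rotated])
  then show ?case by (simp only: m_def power_Suc mult.assoc add_Suc_right)
qed simp

text \<open>
  From a level below \<open>n / 4\<close> there are \<open>n div 12\<close> doublings before a third of \<open>n\<close> is reached.
\<close>
lemma outer_level_small:
  fixes n k :: nat
  assumes "k \<le> n" "k < n div 4 \<or> n < k + n div 4"
  shows "2 ^ (n div 12) * (n choose k) \<le> n choose (n div 2)"
proof -
  have low: "2 ^ (n div 12) * (n choose j) \<le> n choose (n div 2)" if "j < n div 4" for j
  proof -
    have "4 * (n div 4) \<le> n" "12 * (n div 12) \<le> n" by simp_all
    then have "3 * (j + n div 12) \<le> n" using that unfolding distrib_left by linarith
    then have "2 ^ (n div 12) * (n choose j) \<le> n choose (j + n div 12)" by (rule binomial_doubling)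
    also have "\<dots> \<le> n choose (n div 2)" by (rule binomial_maximum)
    finally show ?thesis .
  qed
  show ?thesis
  proof (cases "k < n div 4")
    case False
    then have "n - k < n div 4" using assms by linarith
    then show ?thesis using low[of "n - k"] assms(1) by (simp add: binomial_symmetric[symmetric])
  qed (rule low)
qed

lemma card_outer_le:
  assumes X: "finite X"
  shows "2 ^ (card X div 12) * card (Pow X - inner X) \<le> (card X + 1) * (card X choose (card X div 2))"
proof -
  let ?n = "card X"
  define bad where "bad = {k \<in> {..?n}. k < ?n div 4 \<or> ?n < k + ?n div 4}"
  have fin: "finite bad" by (simp add: bad_def)
  have "Pow X - inner X \<subseteq> (\<Union>k\<in>bad. {w. w \<subseteq> X \<and> card w = k})"
    using X by (auto simp: inner_def bad_def card_mono)
  then have "card (Pow X - inner X) \<le> card (\<Union>k\<in>bad. {w. w \<subseteq> X \<and> card w = k})"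
    by (rule card_mono[rotated]) (use fin X in auto)
  also have "\<dots> \<le> (\<Sum>k\<in>bad. card {w. w \<subseteq> X \<and> card w = k})" by (rule card_UN_le[OF fin])
  also have "\<dots> = (\<Sum>k\<in>bad. ?n choose k)" by (intro sum.cong refl n_subsets X)
  finally have "2 ^ (?n div 12) * card (Pow X - inner X) \<le> 2 ^ (?n div 12) * (\<Sum>k\<in>bad. ?n choose k)"
    by simp
  also have "\<dots> = (\<Sum>k\<in>bad. 2 ^ (?n div 12) * (?n choose k))" by (rule sum_distrib_left)
  also have "\<dots> \<le> (\<Sum>k\<in>bad. ?n choose (?n div 2))"
    by (intro sum_mono outer_level_small) (auto simp: bad_def)
  also have "\<dots> \<le> (?n + 1) * (?n choose (?n div 2))"
  proof -
    have "card bad \<le> card {..?n}" by (rule card_mono) (auto simp: bad_def)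
    then have "card bad * (?n choose (?n div 2)) \<le> (?n + 1) * (?n choose (?n div 2))"
      by (intro mult_right_mono) auto
    then show ?thesis by (simp only: sum_constant of_nat_id)
  qed
  finally show ?thesis .
qed

lemma outer_negligible:
  assumes \<eta>: "0 < \<eta>"
  shows "\<exists>N. \<forall>X :: 'b set. finite X \<and> N \<le> card X \<longrightarrow>
    real (card (Pow X - inner X)) \<le> \<eta> * real (card X choose (card X div 2))"
proof -
  have "(\<lambda>t. real t * (1 / 2) ^ t) \<longlonglongrightarrow> 0"
    by (rule powser_times_n_limit_0) simp
  then have "\<forall>\<^sub>F t in sequentially. real t * (1 / 2) ^ t < \<eta> / 24"
    by (rule order_tendstoD) (use \<eta> in simp)
  then obtain t0 where t0: "\<And>t. t0 \<le> t \<Longrightarrow> real t * (1 / 2) ^ t < \<eta> / 24"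
    by (auto simp: eventually_sequentially)
  show ?thesis
  proof (intro exI[of _ "12 * (t0 + 1)"] allI impI)
    fix X :: "'b set" assume X: "finite X \<and> 12 * (t0 + 1) \<le> card X"
    let ?n = "card X" let ?t = "?n div 12" let ?C = "real (?n choose (?n div 2))"
    have "?n < 12 * ?t + 12" using dividend_less_times_div[of 12 ?n] by simp
    moreover from this have "t0 < ?t" using conjunct2[OF X] unfolding distrib_left by linarith
    ultimately have t: "t0 \<le> ?t" "?n + 1 \<le> 24 * ?t" by linarith+
    have "real (2 ^ ?t * card (Pow X - inner X)) \<le> real ((?n + 1) * (?n choose (?n div 2)))"
      using card_outer_le[of X] X by (intro of_nat_mono) simp
    then have "2 ^ ?t * real (card (Pow X - inner X)) \<le> real (?n + 1) * ?C"
      by (simp only: of_nat_mult of_nat_power of_nat_numeral)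
    also have "real (?n + 1) \<le> real (24 * ?t)" using t(2) by (rule of_nat_mono)
    then have "real (?n + 1) * ?C \<le> real (24 * ?t) * ?C" by (rule mult_right_mono) simp
    also have "real (24 * ?t) = 24 * (real ?t * (1 / 2) ^ ?t) * 2 ^ ?t"
      by (simp add: power_divide)
    also have "\<dots> * ?C \<le> \<eta> * 2 ^ ?t * ?C"
      using t0[OF t(1)] by (intro mult_right_mono) auto
    finally have "2 ^ ?t * real (card (Pow X - inner X)) \<le> 2 ^ ?t * (\<eta> * ?C)"
      by (simp add: mult_ac)
    then show "real (card (Pow X - inner X)) \<le> \<eta> * ?C" by (rule mult_left_le_imp_le) simp
  qed
qed

lemma lubell_inner_ge:
  assumes X: "finite X" and F: "\<F> \<subseteq> Pow X"
    and big: "(s + \<eta>) * real (card X choose (card X div 2)) \<le> real (card \<F>)"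
    and outer: "real (card (Pow X - inner X)) \<le> \<eta> * real (card X choose (card X div 2))"
  shows "s \<le> lubell X (\<F> \<inter> inner X)"
proof -
  let ?C = "real (card X choose (card X div 2))"
  have fin: "finite \<F>" using X F by (meson finite_Pow_iff finite_subset)
  have C: "0 < ?C" by simp
  have "card \<F> \<le> card (\<F> \<inter> inner X) + card (Pow X - inner X)"
  proof -
    have "card \<F> \<le> card ((\<F> \<inter> inner X) \<union> (Pow X - inner X))"
      using F fin X by (intro card_mono) auto
    also have "\<dots> \<le> card (\<F> \<inter> inner X) + card (Pow X - inner X)" by (rule card_Un_le)
    finally show ?thesis .
  qed
  then have "s * ?C \<le> real (card (\<F> \<inter> inner X))"
    using big outer by (simp add: distrib_right)
  then have "s \<le> real (card (\<F> \<inter> inner X)) / ?C" using C by (simp add: pos_le_divide_eq)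
  also have "\<dots> = (\<Sum>w\<in>\<F> \<inter> inner X. 1 / ?C)" by simp
  also have "\<dots> \<le> lubell X (\<F> \<inter> inner X)"
    unfolding lubell_def
  proof (rule sum_mono)
    fix w assume "w \<in> \<F> \<inter> inner X"
    then have "card w \<le> card X" using F X by (auto intro: card_mono)
    then have "0 < real (card X choose card w)" by simp
    moreover have "real (card X choose card w) \<le> ?C" by (intro of_nat_mono binomial_maximum)
    ultimately show "1 / ?C \<le> 1 / real (card X choose card w)" by (intro divide_left_mono) auto
  qed
  finally show ?thesis .
qed

section \<open>Blow-ups in large families\<close>

definition upward :: "'a rel \<Rightarrow> 'a \<Rightarrow> 'a \<Rightarrow> bool" where
  "upward T x u \<longleftrightarrow> (parent T x u, u) \<in> hasse T"

text \<open>
  By uniqueness of parents, every edge of the Hasse diagram of the blow-up joins a copy to the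
  copy of its parent, which the embedding has placed on the correct side.
\<close>
lemma blowup_copy_of_embedding:
  assumes T: "tree_poset T" "x \<in> Field T"
    and emb: "embeds (parent T x) x (upward T x) pool d (copies (hasse_dist T x) d (Field T)) \<iota>"
    and inj: "inj_on \<iota> (copies (hasse_dist T x) d (Field T))"
    and F: "\<forall>u\<in>Field T. pool u \<subseteq> \<F>"
  shows "contains_weak_copy \<F> (blowup T x d)"
proof -
  let ?I = "copies (hasse_dist T x) d (Field T)"
  have I: "blowup_elems T x d = ?I" by (simp add: blowup_elems_def copies_def)
  note P = finite_posetD[OF tree_posetD[OF T(1)]]
  have edge: "\<iota> (u, i) \<subseteq> \<iota> (v, j)" if e: "((u, i), (v, j)) \<in> blowup_edges T x d" for u i v j
  proof -
    have uv: "(u, v) \<in> hasse T" and I2: "(u, i) \<in> ?I" "(v, j) \<in> ?I"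
      and cases: "hasse_dist T x u = hasse_dist T x v + 1 \<and> i div d = j \<or>
        hasse_dist T x v = hasse_dist T x u + 1 \<and> j div d = i"
      using e by (simp_all add: blowup_edges_def I)
    have g: "(v, u) \<in> hasse_graph T" "(u, v) \<in> hasse_graph T"
      using uv by (simp_all add: hasse_graph_def)
    from cases show ?thesis
    proof
      assume c: "hasse_dist T x u = hasse_dist T x v + 1 \<and> i div d = j"
      then have p: "v = parent T x u" by (intro parent_unique[OF T g(1)]) simp
      have "(v, u) \<notin> hasse T" using uv antisymD[OF P(3), of u v] by (auto simp: hasse_def)
      then have "\<not> upward T x u" by (simp add: upward_def p)
      moreover have "u \<noteq> x" using c hasse_dist_self[of T x] by auto
      ultimately show ?thesis
        using embedsD(2)[OF emb I2(1)] c p by (auto simp: toward_def)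
    next
      assume c: "hasse_dist T x v = hasse_dist T x u + 1 \<and> j div d = i"
      then have p: "u = parent T x v" by (intro parent_unique[OF T g(2)]) simp
      have "upward T x v" using uv by (simp add: upward_def p[symmetric])
      moreover have "v \<noteq> x" using c hasse_dist_self[of T x] by auto
      ultimately show ?thesis
        using embedsD(2)[OF emb I2(2)] c p by (auto simp: toward_def)
    qed
  qed
  have path: "\<iota> p \<subseteq> \<iota> q" if "(p, q) \<in> (blowup_edges T x d)\<^sup>+" for p q
    using that
  proof (induction rule: trancl_induct)
    case (base q)
    then show ?case using edge[of "fst p" "snd p" "fst q" "snd q"] by simp
  next
    case (step q r)
    have "\<iota> q \<subseteq> \<iota> r" using step.hyps(2) edge[of "fst q" "snd q" "fst r" "snd r"] by simp
    then show ?case using step.IH by (rule order.trans[rotated])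
  qed
  have "\<iota> ` ?I \<subseteq> \<F>"
  proof
    fix w assume "w \<in> \<iota> ` ?I"
    then obtain u i where ui: "(u, i) \<in> ?I" "w = \<iota> (u, i)" by auto
    moreover have "u \<in> Field T" using ui(1) by (simp add: copies_def)
    ultimately show "w \<in> \<F>" using embedsD(1)[OF emb ui(1)] F by blast
  qed
  moreover have "weak_copy (blowup T x d) (\<iota> ` ?I)"
    unfolding weak_copy_def Field_blowup I
  proof (intro exI[of _ \<iota>] conjI)
    show "bij_betw \<iota> ?I (\<iota> ` ?I)" using inj by (rule inj_on_imp_bij_betw)
    show "\<forall>(p, q)\<in>blowup T x d. \<iota> p \<subseteq> \<iota> q"
    proof
      fix pq assume pq: "pq \<in> blowup T x d"
      obtain p q where "pq = (p, q)" by (cases pq)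
      moreover from this have "p = q \<or> (p, q) \<in> (blowup_edges T x d)\<^sup>+"
        using pq by (auto simp: blowup_def)
      ultimately show "case pq of (p, q) \<Rightarrow> \<iota> p \<subseteq> \<iota> q" using path[of p q] by auto
    qed
  qed
  ultimately show ?thesis unfolding contains_weak_copy_def by blast
qed

lemma blowup_copy_from_pools:
  assumes T: "tree_poset T" "x \<in> Field T" and c: "0 < c"
  shows "\<exists>\<delta>>0. \<exists>N. \<forall>n\<ge>N. \<forall>pool \<F>.
    (\<forall>u\<in>Field T. pool u \<subseteq> \<F> \<inter> inner {1..n}) \<and> pool x \<noteq> {} \<and>
    (\<forall>u\<in>Field T - {x}. \<forall>v\<in>pool (parent T x u). c \<le> degree {1..n} (upward T x u) v (pool u)) \<longrightarrow>
    contains_weak_copy \<F> (blowup T x (nat \<lfloor>\<delta> * real n\<rfloor>))"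
proof -
  let ?V = "Field T"
  have step: "\<forall>u\<in>?V - {x}. parent T x u \<in> ?V \<and> hasse_dist T x u = Suc (hasse_dist T x (parent T x u))"
  proof
    fix u assume "u \<in> ?V - {x}"
    then have "u \<in> ?V" "u \<noteq> x" by auto
    note p = parent_edge[OF T this]
    show "parent T x u \<in> ?V \<and> hasse_dist T x u = Suc (hasse_dist T x (parent T x u))"
      using hasse_graph_Field[OF p(1)] p(2) by simp
  qed
  have "\<forall>u\<in>?V - {x}. parent T x u \<in> ?V" using step by simp
  from rooted_tree_embedding[where par = "parent T x" and depth = "hasse_dist T x" and S = ?V
      and up = "upward T x" and R = 0, OF finite_posetD(1)[OF tree_posetD[OF T(1)]] T(2)
      hasse_dist_self step c order_refl T(2) this]
  obtain \<delta> N b where \<delta>: "0 < \<delta>" and emb: "\<forall>(X :: nat set) pool d.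
      finite X \<and> N \<le> card X \<and> real d \<le> \<delta> * real (card X) \<and>
      (\<forall>u\<in>?V. pool u \<subseteq> inner X) \<and> pool x \<noteq> {} \<and>
      (\<forall>u\<in>?V - {x}. \<forall>v\<in>pool (parent T x u). c \<le> degree X (upward T x u) v (pool u)) \<longrightarrow>
      (\<exists>\<iota> A. separated 0 (copies (hasse_dist T x) d ?V) \<iota> A \<and>
        embeds (parent T x) x (upward T x) pool d (copies (hasse_dist T x) d ?V) \<iota> \<and>
        (\<forall>p\<in>copies (hasse_dist T x) d ?V. finite (A p) \<and> card (A p) \<le> b * d))"
    by (elim exE conjE) (rule that)
  show ?thesis
  proof (rule exI[of _ \<delta>], intro conjI \<delta>, rule exI[of _ N], intro allI impI, elim conjE)
    fix n pool \<F> assume n: "N \<le> n"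
      and pool: "\<forall>u\<in>?V. pool u \<subseteq> \<F> \<inter> inner {1..n}" "pool x \<noteq> {}"
        "\<forall>u\<in>?V - {x}. \<forall>v\<in>pool (parent T x u). c \<le> degree {1..n} (upward T x u) v (pool u)"
    let ?d = "nat \<lfloor>\<delta> * real n\<rfloor>"
    have d: "real ?d \<le> \<delta> * real (card {1..n})" using \<delta> by simp
    have X: "finite {1..n}" "N \<le> card {1..n}" "\<forall>u\<in>?V. pool u \<subseteq> inner {1..n}" "\<forall>u\<in>?V. pool u \<subseteq> \<F>"
      using n pool(1) by auto
    obtain \<iota> A where *: "separated 0 (copies (hasse_dist T x) ?d ?V) \<iota> A"
        "embeds (parent T x) x (upward T x) pool ?d (copies (hasse_dist T x) ?d ?V) \<iota>"
      using emb[THEN spec, THEN spec, THEN spec, THEN mp,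
        OF conjI[OF X(1) conjI[OF X(2) conjI[OF d conjI[OF X(3) conjI[OF pool(2,3)]]]]]]
      by (elim exE conjE) (rule that)
    show "contains_weak_copy \<F> (blowup T x ?d)"
      by (rule blowup_copy_of_embedding[OF T *(2) separated_inj_on[OF *(1)] X(4)])
  qed
qed

text \<open>
  With \<open>a\<close> and \<open>b\<close> the largest distances of vertices above and below \<open>x\<close>, a vertex at distance \<open>k\<close>
  above (below) \<open>x\<close> takes its images from the family left after \<open>a - k\<close> (\<open>b - k\<close>) rounds of peeling.
\<close>
lemma two_way_monotone_blowup:
  fixes T :: "'a rel"
  assumes T: "tree_poset T" "x \<in> Field T" and comp: "comparable_to_all T x" and \<epsilon>: "0 < \<epsilon>"
  shows "\<exists>\<delta>>0. \<exists>N. \<forall>n\<ge>N. \<forall>F \<subseteq> Pow {1..n}.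
    real (card F) \<ge> (real (poset_height T) - 1 + \<epsilon>) * real (n choose (n div 2)) \<longrightarrow>
    contains_weak_copy F (blowup T x (nat \<lfloor>\<delta> * real n\<rfloor>))"
proof -
  note P = finite_posetD[OF tree_posetD[OF T(1)]]
  let ?dist = "hasse_dist T x" and ?h = "real (poset_height T)"
  define a where "a = Max (?dist ` {u. (x, u) \<in> T})"
  define b where "b = Max (?dist ` {u. (u, x) \<in> T})"
  have xx: "(x, x) \<in> T" using P(4) T(2) .
  have fin: "finite {u. (x, u) \<in> T}" "finite {u. (u, x) \<in> T}"
    by (rule finite_subset[OF _ P(1)]; auto simp: Field_def)+
  have dist_a: "?dist u \<le> a" if "(x, u) \<in> T" for u using that fin(1) by (simp add: a_def)
  have dist_b: "?dist u \<le> b" if "(u, x) \<in> T" for u using that fin(2) by (simp add: b_def)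
  have "a \<in> ?dist ` {u. (x, u) \<in> T}" unfolding a_def using fin(1) xx by (intro Max_in) auto
  then obtain u where u: "(x, u) \<in> T" "?dist u = a" by auto
  have "b \<in> ?dist ` {u. (u, x) \<in> T}" unfolding b_def using fin(2) xx by (intro Max_in) auto
  then obtain w where w: "(w, x) \<in> T" "?dist w = b" by auto
  have "b + a + 1 \<le> poset_height T"
    using arms_le_height[OF tree_posetD[OF T(1)] w(1) u(1)] u(2) w(2) by simp
  then have ab: "real a + real b \<le> ?h - 1" by linarith
  \<comment> \<open>Small enough that \<open>(h - 1) / (1 - c)\<close> stays below the mass \<open>h - 1 + \<epsilon> / 2\<close> left in the inner layers.\<close>
  define c where "c = \<epsilon> / (4 * (?h + \<epsilon>))"
  have h\<epsilon>: "0 < ?h + \<epsilon>" using \<epsilon> by (simp add: add_nonneg_pos)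
  have c0: "0 < c" using \<epsilon> h\<epsilon> by (simp add: c_def)
  have ch: "c * (?h + \<epsilon>) = \<epsilon> / 4" using h\<epsilon> by (simp add: c_def field_simps)
  have c1: "c < 1"
  proof -
    have "\<epsilon> < 4 * (?h + \<epsilon>)" using \<epsilon> by simp
    then show ?thesis using h\<epsilon> by (simp add: c_def)
  qed
  have "c * (?h - 1 + \<epsilon> / 2) \<le> c * (?h + \<epsilon>)" using c0 \<epsilon> by (intro mult_left_mono) auto
  then have "?h - 1 < (1 - c) * (?h - 1 + \<epsilon> / 2)"
    using ch \<epsilon> by (simp add: left_diff_distrib)
  then have "(real a + real b) < (1 - c) * (?h - 1 + \<epsilon> / 2)" using ab by linarith
  then have ab_c: "(real a + real b) / (1 - c) < ?h - 1 + \<epsilon> / 2"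
    using c1 by (simp add: pos_divide_less_eq mult.commute)
  obtain \<delta> N where \<delta>: "0 < \<delta>" and copy: "\<forall>n\<ge>N. \<forall>pool \<F>.
    (\<forall>u\<in>Field T. pool u \<subseteq> \<F> \<inter> inner {1..n}) \<and> pool x \<noteq> {} \<and>
    (\<forall>u\<in>Field T - {x}. \<forall>v\<in>pool (parent T x u). c \<le> degree {1..n} (upward T x u) v (pool u)) \<longrightarrow>
    contains_weak_copy \<F> (blowup T x (nat \<lfloor>\<delta> * real n\<rfloor>))"
    using blowup_copy_from_pools[OF T c0] by (elim exE conjE) (rule that)
  obtain M where M: "\<forall>X :: nat set. finite X \<and> M \<le> card X \<longrightarrow>
    real (card (Pow X - inner X)) \<le> \<epsilon> / 2 * real (card X choose (card X div 2))"
    using outer_negligible[OF half_gt_zero[OF \<epsilon>]] by (elim exE) (rule that)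
  show ?thesis
  proof (rule exI[of _ \<delta>], intro conjI \<delta>, rule exI[of _ "max N M"], intro allI impI)
    fix n F assume n: "max N M \<le> n" and F: "F \<subseteq> Pow {1..n}"
      and big: "real (card F) \<ge> (?h - 1 + \<epsilon>) * real (n choose (n div 2))"
    let ?X = "{1..n}"
    let ?\<F> = "F \<inter> inner ?X"
    have X: "finite ?X" "M \<le> card ?X" and FX: "?\<F> \<subseteq> Pow ?X" using n F by auto
    have "?h - 1 + \<epsilon> / 2 \<le> lubell ?X ?\<F>"
      by (rule lubell_inner_ge[OF X(1) F _ M[rule_format, OF conjI[OF X]]])
        (use big in \<open>simp add: algebra_simps\<close>)
    then have "(real a + real b) / (1 - c) < lubell ?X ?\<F>" using ab_c by linarith
    then have root: "peel ?X True c ?\<F> a \<inter> peel ?X False c ?\<F> b \<noteq> {}"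
      by (intro two_way_root_exists[OF X(1) FX c1]) simp
    define pool where "pool u = (if u = x then peel ?X True c ?\<F> a \<inter> peel ?X False c ?\<F> b
      else if (x, u) \<in> T then peel ?X True c ?\<F> (a - ?dist u) else peel ?X False c ?\<F> (b - ?dist u))" for u
    have above: "pool u \<subseteq> peel ?X True c ?\<F> (a - ?dist u)" if "(x, u) \<in> T" for u
      using that by (auto simp: pool_def hasse_dist_self)
    have below: "pool u \<subseteq> peel ?X False c ?\<F> (b - ?dist u)" if "(u, x) \<in> T" for u
      using that antisymD[OF P(3), of x u] by (auto simp: pool_def hasse_dist_self)
    have sub: "peel ?X up c ?\<F> i \<subseteq> ?\<F>" for up i by (rule peel_subset)
    have "pool u \<subseteq> ?\<F>" for u
      unfolding pool_def
      by (cases "u = x"; cases "(x, u) \<in> T") (simp_all only: if_True if_False simp_thms sub le_infI1)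
    then have "\<forall>u\<in>Field T. pool u \<subseteq> ?\<F>" by blast
    moreover have "pool x \<noteq> {}" using root by (simp add: pool_def)
    moreover have "c \<le> degree ?X (upward T x u) v (pool u)"
      if u: "u \<in> Field T - {x}" and v: "v \<in> pool (parent T x u)" for u v
    proof -
      let ?p = "parent T x u"
      have uF: "u \<in> Field T" "u \<noteq> x" using u by auto
      have du: "?dist u = Suc (?dist ?p)" by (rule parent_edge(2)[OF T uF])
      consider "(x, u) \<in> T" | "(u, x) \<in> T" "(x, u) \<notin> T"
        using comp uF(1) by (auto simp: comparable_to_all_def)
      then show ?thesis
      proof cases
        case 1
        note p = parent_of_above[OF T comp 1 uF(2)]
        have "v \<in> peel ?X True c ?\<F> (a - ?dist ?p)" using above[OF p(2)] v by blast
        moreover have "a - ?dist ?p = Suc (a - ?dist u)" using dist_a[OF 1] du by simp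
        ultimately have "c < degree ?X True v (peel ?X True c ?\<F> (a - ?dist u))" by simp
        then show ?thesis using p(1) 1 uF(2) by (simp add: upward_def pool_def)
      next
        case 2
        note p = parent_of_below[OF T comp 2(1) uF(2)]
        have "(?p, u) \<notin> hasse T" using p(1) antisymD[OF P(3), of u ?p] by (auto simp: hasse_def)
        then have up: "upward T x u = False" by (simp add: upward_def)
        have "v \<in> peel ?X False c ?\<F> (b - ?dist ?p)" using below[OF p(2)] v by blast
        moreover have "b - ?dist ?p = Suc (b - ?dist u)" using dist_b[OF 2(1)] du by simp
        ultimately have "c < degree ?X False v (peel ?X False c ?\<F> (b - ?dist u))" by simp
        then show ?thesis using 2 uF(2) by (simp add: up pool_def)
      qed
    qed
    ultimately show "contains_weak_copy F (blowup T x (nat \<lfloor>\<delta> * real n\<rfloor>))"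
      using copy n by (intro copy[rule_format, of n pool F]) simp_all
  qed
qed

text \<open>
  In height 2 no vertex is both the lower and the upper end of a cover, so the upper ends can be
  mapped to \<open>\<U>\<close> and all other vertices to \<open>\<L>\<close>.
\<close>
lemma height_two_blowup:
  fixes T :: "'a rel"
  assumes T: "tree_poset T" "x \<in> Field T" and h: "poset_height T = 2" and \<epsilon>: "0 < \<epsilon>"
  shows "\<exists>\<delta>>0. \<exists>N. \<forall>n\<ge>N. \<forall>F \<subseteq> Pow {1..n}.
    real (card F) \<ge> (1 + \<epsilon>) * real (n choose (n div 2)) \<longrightarrow>
    contains_weak_copy F (blowup T x (nat \<lfloor>\<delta> * real n\<rfloor>))"
proof -
  note P = finite_posetD[OF tree_posetD[OF T(1)]]
  have no3: False if "(u, v) \<in> hasse T" "(v, w) \<in> hasse T" for u v w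
  proof -
    have "(u, w) \<in> hasse T ^^ 2" using that by (auto simp: numeral_2_eq_2)
    moreover have "u \<in> Field T" using that(1) by (auto simp: hasse_def Field_def)
    ultimately have "Suc 2 \<le> poset_height T" by (rule poset_height_ge[OF tree_posetD[OF T(1)]])
    then show False using h by simp
  qed
  \<comment> \<open>Small enough that \<open>(1 - 2c) (1 + \<epsilon> / 2) > 1\<close>.\<close>
  define c where "c = \<epsilon> / (8 * (1 + \<epsilon>))"
  have c0: "0 < c" using \<epsilon> by (simp add: c_def)
  have "c * (8 * (1 + \<epsilon>)) = \<epsilon>" using \<epsilon> by (simp add: c_def)
  moreover have "2 * c * (1 + \<epsilon> / 2) \<le> 2 * c * (1 + \<epsilon>)" using c0 \<epsilon> by (intro mult_left_mono) auto
  ultimately have c2: "1 < (1 - 2 * c) * (1 + \<epsilon> / 2)" using \<epsilon> by (simp add: algebra_simps)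
  then have c3: "0 < 1 - 2 * c"
    using zero_less_mult_pos2[of "1 - 2 * c" "1 + \<epsilon> / 2"] \<epsilon> by simp
  obtain \<delta> N where \<delta>: "0 < \<delta>" and copy: "\<forall>n\<ge>N. \<forall>pool \<F>.
    (\<forall>u\<in>Field T. pool u \<subseteq> \<F> \<inter> inner {1..n}) \<and> pool x \<noteq> {} \<and>
    (\<forall>u\<in>Field T - {x}. \<forall>v\<in>pool (parent T x u). c \<le> degree {1..n} (upward T x u) v (pool u)) \<longrightarrow>
    contains_weak_copy \<F> (blowup T x (nat \<lfloor>\<delta> * real n\<rfloor>))"
    using blowup_copy_from_pools[OF T c0] by (elim exE conjE) (rule that)
  obtain M where M: "\<forall>X :: nat set. finite X \<and> M \<le> card X \<longrightarrow>
    real (card (Pow X - inner X)) \<le> \<epsilon> / 2 * real (card X choose (card X div 2))"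
    using outer_negligible[OF half_gt_zero[OF \<epsilon>]] by (elim exE) (rule that)
  show ?thesis
  proof (rule exI[of _ \<delta>], intro conjI \<delta>, rule exI[of _ "max N M"], intro allI impI)
    fix n F assume n: "max N M \<le> n" and F: "F \<subseteq> Pow {1..n}"
      and big: "real (card F) \<ge> (1 + \<epsilon>) * real (n choose (n div 2))"
    let ?X = "{1..n}"
    let ?\<F> = "F \<inter> inner ?X"
    have X: "finite ?X" "M \<le> card ?X" and FX: "?\<F> \<subseteq> Pow ?X" using n F by auto
    have "1 + \<epsilon> / 2 \<le> lubell ?X ?\<F>"
      by (rule lubell_inner_ge[OF X(1) F _ M[rule_format, OF conjI[OF X]]])
        (use big in \<open>simp add: algebra_simps\<close>)
    then have "(1 - 2 * c) * (1 + \<epsilon> / 2) \<le> (1 - 2 * c) * lubell ?X ?\<F>"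
      using c3 by (intro mult_left_mono) auto
    then have "1 < (1 - 2 * c) * lubell ?X ?\<F>" using c2 by linarith
    then obtain \<L> \<U> where LU: "\<L> \<subseteq> ?\<F>" "\<U> \<subseteq> ?\<F>" "\<L> \<noteq> {}" "\<U> \<noteq> {}"
      and degL: "\<And>l. l \<in> \<L> \<Longrightarrow> c \<le> degree ?X True l \<U>"
      and degU: "\<And>u. u \<in> \<U> \<Longrightarrow> c \<le> degree ?X False u \<L>"
      using high_degree_pair_exists[OF X(1) FX less_imp_le[OF c0]] by metis
    define pool where "pool u = (if \<exists>w. (w, u) \<in> hasse T then \<U> else \<L>)" for u
    have "\<forall>u\<in>Field T. pool u \<subseteq> ?\<F>" using LU by (simp add: pool_def)
    moreover have "pool x \<noteq> {}" using LU by (simp add: pool_def)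
    moreover have "c \<le> degree ?X (upward T x u) v (pool u)"
      if u: "u \<in> Field T - {x}" and v: "v \<in> pool (parent T x u)" for u v
    proof -
      let ?p = "parent T x u"
      have edge: "(?p, u) \<in> hasse_graph T" using u by (intro parent_edge(1)[OF T]) auto
      show ?thesis
      proof (cases "(?p, u) \<in> hasse T")
        case True
        then have "pool u = \<U>" "pool ?p = \<L>" using no3 by (auto simp: pool_def)
        then show ?thesis using degL v True by (simp add: upward_def)
      next
        case False
        then have "(u, ?p) \<in> hasse T" using edge by (simp add: hasse_graph_def)
        then have "pool u = \<L>" "pool ?p = \<U>" using no3 by (auto simp: pool_def)
        then show ?thesis using degU v False by (simp add: upward_def)
      qed
    qed
    ultimately show "contains_weak_copy F (blowup T x (nat \<lfloor>\<delta> * real n\<rfloor>))"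
      using copy n by (intro copy[rule_format, of n pool F]) simp_all
  qed
qed

theorem theorem1p13:
  shows "(\<forall>(T :: 'a rel) x (\<epsilon> :: real).
            two_way_monotone T \<longrightarrow> x \<in> Field T \<longrightarrow> comparable_to_all T x \<longrightarrow> \<epsilon> > 0 \<longrightarrow>
            (\<exists>\<delta> :: real. \<delta> > 0 \<and> (\<exists>N :: nat. \<forall>n\<ge>N. \<forall>F \<subseteq> Pow {1..n}.
               real (card F) \<ge> (real (poset_height T) - 1 + \<epsilon>) * real (n choose (n div 2)) \<longrightarrow>
               contains_weak_copy F (blowup T x (nat \<lfloor>\<delta> * real n\<rfloor>)))))
       \<and> (\<forall>(T :: 'a rel) x (\<epsilon> :: real).
            tree_poset T \<longrightarrow> poset_height T = 2 \<longrightarrow> x \<in> Field T \<longrightarrow> \<epsilon> > 0 \<longrightarrow>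
            (\<exists>\<delta> :: real. \<delta> > 0 \<and> (\<exists>N :: nat. \<forall>n\<ge>N. \<forall>F \<subseteq> Pow {1..n}.
               real (card F) \<ge> (1 + \<epsilon>) * real (n choose (n div 2)) \<longrightarrow>
               contains_weak_copy F (blowup T x (nat \<lfloor>\<delta> * real n\<rfloor>)))))"
proof (intro conjI allI impI)
  fix T :: "'a rel" and x and \<epsilon> :: real
  assume "two_way_monotone T" "x \<in> Field T" "comparable_to_all T x" "\<epsilon> > 0"
  moreover from this have "tree_poset T" by (simp add: two_way_monotone_def)
  ultimately show "\<exists>\<delta> :: real. \<delta> > 0 \<and> (\<exists>N :: nat. \<forall>n\<ge>N. \<forall>F \<subseteq> Pow {1..n}.
      real (card F) \<ge> (real (poset_height T) - 1 + \<epsilon>) * real (n choose (n div 2)) \<longrightarrow>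
      contains_weak_copy F (blowup T x (nat \<lfloor>\<delta> * real n\<rfloor>)))"
    by (intro two_way_monotone_blowup)
next
  fix T :: "'a rel" and x and \<epsilon> :: real
  assume "tree_poset T" "poset_height T = 2" "x \<in> Field T" "\<epsilon> > 0"
  then show "\<exists>\<delta> :: real. \<delta> > 0 \<and> (\<exists>N :: nat. \<forall>n\<ge>N. \<forall>F \<subseteq> Pow {1..n}.
      real (card F) \<ge> (1 + \<epsilon>) * real (n choose (n div 2)) \<longrightarrow>
      contains_weak_copy F (blowup T x (nat \<lfloor>\<delta> * real n\<rfloor>)))"
    by (intro height_two_blowup)
qed

end
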